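(* Let $\Lambda$ be a lattice with an automorphism $F=1+D$ satisfying $\Lambda[D]=\Lambda[D^2]$, and let $(\cdot,\cdot)$ be a non-degenerate symmetric $F$-invariant $\mathbb{Q}$-valued pairing on $V=\Lambda\otimes\mathbb{Q}$ with $\Lambda^\vee\subseteq\Lambda$. Write the characteristic polynomial of $F$ on $\Lambda$ as $\pm(t-1)^rp(t)$ with $p(1)>0$. Then for all positive integers $e,f$, up to multiplication by squares of nonzero rationals, $$\left|\left(\Lambda/e\Lambda^\vee\right)^{F^f}\right|\sim\begin{cases}\left|\frac{\Lambda^F}{(\Lambda^{\vee})^F}\right|\cdot\frac{p(1)}{|\mathfrak{B}_{\Lambda,\Lambda^\vee}|\cdot|\mathcal{T}_D(\Lambda)|}\cdot e^r&\text{if }2\nmid e,\ 2\nmid f,\\ \left|\frac{\Lambda^F}{(\Lambda^{\vee})^F}\right|\cdot\frac{p(1)}{|\mathcal{T}_D(\Lambda)|}\cdot e^r&\text{if }2\mid e,\ 2\nmid f,\\ \left|\Lambda/\Lambda^\vee\right|\cdot e^{\mathrm{rk}\,\Lambda}&\text{if }2\mid f.\end{cases}$$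
   Context: $V[D]=\ker D$ on $V$, and $V=DV\oplus V[D]$. $\Lambda^\vee=\{v\in V:(v,\lambda)\in\mathbb{Z}\ \forall\lambda\in\Lambda\}$. $\mathcal{T}_D(\Lambda)=\Lambda/\big((\Lambda\cap DV)+(\Lambda\cap V[D])\big)$ and $\mathfrak{B}_{\Lambda,\Lambda^\vee}=\dfrac{\Lambda+D^{-1}\Lambda^\vee}{\Lambda+V[D]}$ with $D^{-1}\Lambda^\vee=\{v\in V:Dv\in\Lambda^\vee\}$. Superscript $F$ denotes fixed points. *)

theory Defs
  imports
    "Jordan_Normal_Form.Char_Poly"
    "HOL-Library.Set_Algebras"
    "HOL-Algebra.Coset"
begin

text \<open>
  Throughout, \<open>scale\<close> is the scalar multiplication of a rational vector space whose
  underlying set is the type \<open>'v\<close>. A lattice \<open>\<Lambda>\<close> is a free \<open>\<int>\<close>-module of finite rank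
  sitting in \<open>V = \<Lambda> \<otimes> \<rat>\<close>, that is, the \<open>\<int>\<close>-span of finitely many vectors that are linearly
  independent over \<open>\<int>\<close> and span \<open>V\<close> over \<open>\<rat>\<close>. Rank \<open>0\<close> is allowed.
\<close>

definition int_scale :: "(rat \<Rightarrow> 'v \<Rightarrow> 'v) \<Rightarrow> int \<Rightarrow> 'v \<Rightarrow> 'v::ab_group_add" where
  "int_scale scale k v = scale (of_int k) v"

definition lattice_basis ::
    "(rat \<Rightarrow> 'v \<Rightarrow> 'v) \<Rightarrow> 'v::ab_group_add set \<Rightarrow> 'v list \<Rightarrow> bool" where
  "lattice_basis scale \<Lambda> bs \<longleftrightarrow>
     distinct bs \<and>
     \<not> Modules.module.dependent (int_scale scale) (set bs) \<and>
     Modules.module.span (int_scale scale) (set bs) = \<Lambda> \<and>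
     Modules.module.span scale (set bs) = UNIV"

definition is_lattice :: "(rat \<Rightarrow> 'v \<Rightarrow> 'v) \<Rightarrow> 'v::ab_group_add set \<Rightarrow> bool" where
  "is_lattice scale \<Lambda> \<longleftrightarrow> (\<exists>bs. lattice_basis scale \<Lambda> bs)"

text \<open>
  The rank and the characteristic polynomial do not depend on the basis, so an arbitrary
  one is chosen.
\<close>

definition some_basis :: "(rat \<Rightarrow> 'v \<Rightarrow> 'v) \<Rightarrow> 'v::ab_group_add set \<Rightarrow> 'v list" where
  "some_basis scale \<Lambda> = (SOME bs. lattice_basis scale \<Lambda> bs)"

definition lattice_rank :: "(rat \<Rightarrow> 'v \<Rightarrow> 'v) \<Rightarrow> 'v::ab_group_add set \<Rightarrow> nat" where
  "lattice_rank scale \<Lambda> = length (some_basis scale \<Lambda>)"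

definition endo_mat ::
    "(rat \<Rightarrow> 'v \<Rightarrow> 'v) \<Rightarrow> 'v::ab_group_add list \<Rightarrow> ('v \<Rightarrow> 'v) \<Rightarrow> int mat" where
  "endo_mat scale bs F = mat (length bs) (length bs)
     (\<lambda>(i, j). Modules.module.representation (int_scale scale) (set bs) (F (bs ! j)) (bs ! i))"

definition lattice_char_poly ::
    "(rat \<Rightarrow> 'v \<Rightarrow> 'v) \<Rightarrow> 'v::ab_group_add set \<Rightarrow> ('v \<Rightarrow> 'v) \<Rightarrow> int poly" where
  "lattice_char_poly scale \<Lambda> F = char_poly (endo_mat scale (some_basis scale \<Lambda>) F)"

definition nondeg_sym_pairing ::
    "(rat \<Rightarrow> 'v \<Rightarrow> 'v) \<Rightarrow> ('v::ab_group_add \<Rightarrow> 'v \<Rightarrow> rat) \<Rightarrow> bool" where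
  "nondeg_sym_pairing scale B \<longleftrightarrow>
     (\<forall>v. Vector_Spaces.linear scale (*) (B v)) \<and>
     (\<forall>w. Vector_Spaces.linear scale (*) (\<lambda>v. B v w)) \<and>
     (\<forall>v w. B v w = B w v) \<and>
     (\<forall>v. (\<forall>w. B v w = 0) \<longrightarrow> v = 0)"

definition dual_lattice :: "('v \<Rightarrow> 'v \<Rightarrow> rat) \<Rightarrow> 'v set \<Rightarrow> 'v set" where
  "dual_lattice B \<Lambda> = {v. \<forall>l\<in>\<Lambda>. B v l \<in> \<int>}"

definition torsion_in :: "'v set \<Rightarrow> ('v \<Rightarrow> 'v) \<Rightarrow> 'v::ab_group_add set" where
  "torsion_in A D = {v \<in> A. D v = 0}"

definition fixed_in :: "'v set \<Rightarrow> ('v \<Rightarrow> 'v) \<Rightarrow> 'v set" where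
  "fixed_in A F = {v \<in> A. F v = v}"

definition quot_group :: "'v::ab_group_add set \<Rightarrow> 'v set \<Rightarrow> 'v set monoid" where
  "quot_group A B = \<lparr>carrier = A, mult = (+), one = 0\<rparr> Mod B"

definition quot_card :: "'v::ab_group_add set \<Rightarrow> 'v set \<Rightarrow> nat" where
  "quot_card A B = card (carrier (quot_group A B))"

text \<open>
  If \<open>\<phi>\<close> is additive and \<open>\<phi> ` B = B\<close>, then the map that \<open>\<phi>\<close> induces on \<open>A / B\<close> sends a
  coset \<open>C\<close> to its image \<open>\<phi> ` C\<close>.
\<close>

definition quot_fixed ::
    "'v::ab_group_add set \<Rightarrow> 'v set \<Rightarrow> ('v \<Rightarrow> 'v) \<Rightarrow> 'v set set" where
  "quot_fixed A B \<phi> = fixed_in (carrier (quot_group A B)) (\<lambda>C. \<phi> ` C)"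

definition T_group :: "('v \<Rightarrow> 'v) \<Rightarrow> 'v::ab_group_add set \<Rightarrow> 'v set monoid" where
  "T_group D \<Lambda> = quot_group \<Lambda> ((\<Lambda> \<inter> range D) + (\<Lambda> \<inter> torsion_in UNIV D))"

definition B_group ::
    "('v \<Rightarrow> 'v) \<Rightarrow> 'v::ab_group_add set \<Rightarrow> 'v set \<Rightarrow> 'v set monoid" where
  "B_group D \<Lambda> \<Lambda>' = quot_group (\<Lambda> + D -` \<Lambda>') (\<Lambda> + torsion_in UNIV D)"

definition sq_equiv :: "rat \<Rightarrow> rat \<Rightarrow> bool" where
  "sq_equiv x y \<longleftrightarrow> (\<exists>q. q \<noteq> 0 \<and> x = q\<^sup>2 * y)"

end

theory Submission
  imports Defs
begin

text \<open>
  Write \<open>[A : C]\<close> for the index of a subgroup. A finite group with a nondegenerate alternating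
  form with values in \<open>\<rat>/\<int>\<close> has square order, and all square classes are found by producing such
  forms. Put \<open>M = e\<Lambda>'\<close> with \<open>\<Lambda>' = \<Lambda>\<^sup>\<or>\<close>; then \<open>(\<cdot>,\<cdot>)/e\<close> is a perfect pairing on \<open>\<Lambda>/M\<close>.

  For \<open>f = 2m\<close> the form \<open>(F\<^sup>fx - x, F\<^sup>my)/e\<close> is alternating, and its radical consists of the classes
  fixed by \<open>F\<^sup>f\<close>. For \<open>f = 2m + 1\<close> the form \<open>((1 + F)(F\<^sup>f - 1)x, F\<^bsup>m+1\<^esup>y)/e\<close> is alternating. It remains to
  control the kernel of \<open>1 + F\<close> on the image of \<open>F\<^sup>f - 1\<close>, which does not depend on the odd number \<open>f\<close>:
  where \<open>F = -1\<close>, the sum \<open>1 + F + \<dots> + F\<^bsup>f-1\<^esup>\<close> is the identity. This reduces odd \<open>f\<close> to \<open>f = 1\<close>.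

  For \<open>f = 1\<close>, applying \<open>D\<close> and counting indices along
  \<open>eDY \<le> eD\<Lambda>' \<le> D\<Lambda> \<inter> e\<Lambda>' \<le> eY\<close> with \<open>Y = \<Lambda>' \<inter> DV\<close> expresses the number of fixed classes exactly by
  \<open>|\<Lambda>\<^sup>F/\<Lambda>'\<^sup>F|\<close>, \<open>e\<^sup>r\<close>, \<open>p(1) = [Y : DY]\<close>, the order of \<open>\<T>\<^sub>D(\<Lambda>')\<close>, which is dual to \<open>\<T>\<^sub>D(\<Lambda>)\<close>, and
  \<open>[eY : eY \<inter> D\<Lambda>]\<close>. The last index is the order of \<open>eX\<close>, where \<open>X = Y/(Y \<inter> D\<Lambda>)\<close> is isomorphic to
  \<open>\<BB>\<^bsub>\<Lambda>,\<Lambda>'\<^esub>\<close> and carries the perfect form \<open>(D\<^sup>-\<^sup>1u, v)\<close>. That form is skew and twice it is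
  alternating, so \<open>|eX|\<close> is a square for even \<open>e\<close> and agrees with \<open>|X|\<close> up to squares for odd \<open>e\<close>.
\<close>

section \<open>Subgroups of an additive group, given as sets\<close>

definition add_subgroup :: "'a::ab_group_add set \<Rightarrow> bool" where
  "add_subgroup A \<longleftrightarrow> 0 \<in> A \<and> (\<forall>x\<in>A. \<forall>y\<in>A. x - y \<in> A)"

lemma add_subgroup_zero: "add_subgroup A \<Longrightarrow> 0 \<in> A"
  by (simp add: add_subgroup_def)

lemma add_subgroup_diff: "add_subgroup A \<Longrightarrow> x \<in> A \<Longrightarrow> y \<in> A \<Longrightarrow> x - y \<in> A"
  by (simp add: add_subgroup_def)

lemma add_subgroup_uminus: "add_subgroup A \<Longrightarrow> x \<in> A \<Longrightarrow> - x \<in> A"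
  using add_subgroup_diff[of A 0 x] add_subgroup_zero by fastforce

lemma add_subgroup_add: "add_subgroup A \<Longrightarrow> x \<in> A \<Longrightarrow> y \<in> A \<Longrightarrow> x + y \<in> A"
  using add_subgroup_diff[of A x "- y"] add_subgroup_uminus[of A y] by simp

lemmas add_subgroup_closed =
  add_subgroup_zero add_subgroup_diff add_subgroup_uminus add_subgroup_add

lemma add_subgroup_Int: "add_subgroup A \<Longrightarrow> add_subgroup B \<Longrightarrow> add_subgroup (A \<inter> B)"
  by (simp add: add_subgroup_def)

lemma add_subgroup_plus:
  assumes "add_subgroup A" "add_subgroup B"
  shows "add_subgroup (A + B)"
proof -
  have "a + b - (a' + b') \<in> A + B" if "a \<in> A" "b \<in> B" "a' \<in> A" "b' \<in> B" for a b a' b'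
  proof -
    have "a + b - (a' + b') = (a - a') + (b - b')" by simp
    then show ?thesis using that assms by (metis add_subgroup_diff set_plus_intro)
  qed
  moreover have "0 \<in> A + B"
    using assms by (metis add_subgroup_zero set_zero_plus2 subset_iff)
  ultimately show ?thesis
    unfolding add_subgroup_def by (auto elim!: set_plus_elim)
qed

lemma additive_diffI:
  fixes h :: "'a::ab_group_add \<Rightarrow> 'b::ab_group_add"
  assumes "\<And>x y. h (x + y) = h x + h y"
  shows "h (x - y) = h x - h y"
  using assms[of "x - y" y] by (simp only: eq_diff_eq diff_add_cancel)

lemma add_subgroup_image:
  assumes "add_subgroup A" "\<And>x y. h (x - y) = h x - (h y :: 'b::ab_group_add)"
  shows "add_subgroup (h ` A)"
proof -
  have "h 0 = 0" using assms(2)[of 0 0] by simp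
  moreover have "h x - h y \<in> h ` A" if "x \<in> A" "y \<in> A" for x y
    using that assms(1) by (metis assms(2) add_subgroup_diff image_eqI)
  ultimately show ?thesis
    using add_subgroup_zero[OF assms(1)] unfolding add_subgroup_def by (metis imageE image_eqI)
qed

lemma add_subgroup_preimage:
  assumes "add_subgroup A" "add_subgroup B" "\<And>x y. h (x - y) = h x - (h y :: 'b::ab_group_add)"
  shows "add_subgroup {a \<in> A. h a \<in> B}"
proof -
  have "h 0 = 0" using assms(3)[of 0 0] by simp
  then show ?thesis
    using assms unfolding add_subgroup_def by auto
qed

section \<open>Indices of subgroups\<close>

lemma carrier_quot_group: "carrier (quot_group A B) = (\<lambda>a. (\<lambda>b. b + a) ` B) ` A"
  unfolding quot_group_def FactGroup_def RCOSETS_def r_coset_def by auto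

lemma coset_eq_iff:
  fixes a b :: "'a::ab_group_add"
  assumes "add_subgroup B"
  shows "(\<lambda>c. c + a) ` B = (\<lambda>c. c + b) ` B \<longleftrightarrow> a - b \<in> B"
proof
  assume "(\<lambda>c. c + a) ` B = (\<lambda>c. c + b) ` B"
  moreover have "a \<in> (\<lambda>c. c + a) ` B"
    using add_subgroup_zero[OF assms] by (force simp: image_iff)
  ultimately obtain c where "c \<in> B" "a = c + b" by auto
  then show "a - b \<in> B" by simp
next
  have *: "(\<lambda>c. c + a) ` B \<subseteq> (\<lambda>c. c + b) ` B" if "a - b \<in> B" for a b
  proof
    fix x assume "x \<in> (\<lambda>c. c + a) ` B"
    then obtain c where "c \<in> B" "x = c + a" by auto
    then have "c + (a - b) \<in> B" "x = c + (a - b) + b"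
      using add_subgroup_add[OF assms _ that] by (simp_all add: add.assoc)
    then show "x \<in> (\<lambda>c. c + b) ` B" by blast
  qed
  assume "a - b \<in> B"
  moreover from this have "b - a \<in> B"
    using add_subgroup_uminus[OF assms, of "a - b"] by simp
  ultimately show "(\<lambda>c. c + a) ` B = (\<lambda>c. c + b) ` B"
    using * by blast
qed

text \<open>Sending \<open>f x\<close> to \<open>g x\<close> is a bijection between the two images,
  so no finiteness is assumed and infinite indices, which count as 0, are covered.\<close>

lemma card_image_cong_fibres:
  assumes "\<And>x y. x \<in> A \<Longrightarrow> y \<in> A \<Longrightarrow> f x = f y \<longleftrightarrow> g x = g y"
  shows "card (f ` A) = card (g ` A)"
proof (rule bij_betw_same_card)
  have 1: "g (inv_into A f (f x)) = g x" if "x \<in> A" for x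
    by (metis assms f_inv_into_f image_eqI inv_into_into that)
  show "bij_betw (\<lambda>u. g (inv_into A f u)) (f ` A) (g ` A)"
    unfolding bij_betw_def
  proof
    show "inj_on (\<lambda>u. g (inv_into A f u)) (f ` A)"
      by (auto simp: inj_on_def 1 assms)
    show "(\<lambda>u. g (inv_into A f u)) ` f ` A = g ` A"
      by (auto simp: image_image 1)
  qed
qed

text \<open>The map \<open>h\<close> induces an isomorphism from A/B to A'/B'. Phrasing this with
  representatives lets one lemma serve as first and, with \<open>h\<close> the identity, as second
  isomorphism theorem.\<close>

lemma quot_card_iso:
  fixes h :: "'a::ab_group_add \<Rightarrow> 'b::ab_group_add"
  assumes B: "add_subgroup B'" "add_subgroup A" "add_subgroup B"
    and h: "\<And>x y. x \<in> A \<Longrightarrow> y \<in> A \<Longrightarrow> h (x - y) = h x - h y"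
    and into: "\<And>x. x \<in> A \<Longrightarrow> h x \<in> A'"
    and onto: "\<And>y. y \<in> A' \<Longrightarrow> \<exists>x\<in>A. y - h x \<in> B'"
    and pre: "\<And>x. x \<in> A \<Longrightarrow> x \<in> B \<longleftrightarrow> h x \<in> B'"
  shows "quot_card A B = quot_card A' B'"
proof -
  have "(\<lambda>y. (\<lambda>b. b + y) ` B') ` A' = (\<lambda>x. (\<lambda>b. b + h x) ` B') ` A"
  proof (intro subset_antisym subsetI)
    fix C assume "C \<in> (\<lambda>y. (\<lambda>b. b + y) ` B') ` A'"
    then obtain y where y: "y \<in> A'" "C = (\<lambda>b. b + y) ` B'" by auto
    then obtain x where "x \<in> A" "y - h x \<in> B'" using onto by blast
    then show "C \<in> (\<lambda>x. (\<lambda>b. b + h x) ` B') ` A"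
      using y coset_eq_iff[OF B(1)] by blast
  qed (use into in auto)
  moreover have "card ((\<lambda>a. (\<lambda>b. b + a) ` B) ` A) = card ((\<lambda>x. (\<lambda>b. b + h x) ` B') ` A)"
  proof (rule card_image_cong_fibres)
    fix x y assume "x \<in> A" "y \<in> A"
    then show "(\<lambda>b. b + x) ` B = (\<lambda>b. b + y) ` B \<longleftrightarrow> (\<lambda>b. b + h x) ` B' = (\<lambda>b. b + h y) ` B'"
      using pre[of "x - y"] h[of x y] add_subgroup_diff[OF B(2)]
      by (simp add: coset_eq_iff B)
  qed
  ultimately show ?thesis
    by (simp add: quot_card_def carrier_quot_group)
qed

text \<open>A choice \<rho> of representatives modulo B identifies A/C with the product of A/B and
  B/C as sets, by sending \<open>a\<close> to the class of \<open>a\<close> and the class of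
  \<open>a - \<rho> a\<close>. This is valid for infinite indices too.\<close>

lemma quot_card_mult:
  fixes A :: "'a::ab_group_add set"
  assumes A: "add_subgroup A" and B: "add_subgroup B" and C: "add_subgroup C"
    and sub: "C \<subseteq> B" "B \<subseteq> A"
  shows "quot_card A C = quot_card A B * quot_card B C"
proof -
  define cB cC where "cB = (\<lambda>a. (\<lambda>b. b + a) ` B)" and "cC = (\<lambda>a. (\<lambda>b. b + a) ` C)"
  have cB: "cB a = cB b \<longleftrightarrow> a - b \<in> B" and cC: "cC a = cC b \<longleftrightarrow> a - b \<in> C" for a b
    unfolding cB_def cC_def by (rule coset_eq_iff, fact)+
  define \<rho> where "\<rho> a = (SOME a'. a' \<in> A \<and> cB a' = cB a)" for a
  have \<rho>: "\<rho> a \<in> A" "cB (\<rho> a) = cB a" if "a \<in> A" for a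
    using someI[of "\<lambda>a'. a' \<in> A \<and> cB a' = cB a" a] that unfolding \<rho>_def by auto
  have \<rho>_cong: "\<rho> a = \<rho> b" if "cB a = cB b" for a b
    unfolding \<rho>_def using that by simp
  have \<rho>B: "a - \<rho> a \<in> B" if "a \<in> A" for a
    using \<rho>(2)[OF that] cB by metis
  let ?g = "\<lambda>a. (cB a, cC (a - \<rho> a))"
  have "card (cC ` A) = card (?g ` A)"
  proof (rule card_image_cong_fibres)
    fix x y assume xy: "x \<in> A" "y \<in> A"
    show "cC x = cC y \<longleftrightarrow> ?g x = ?g y"
    proof (cases "cB x = cB y")
      case True
      then show ?thesis using \<rho>_cong[OF True] by (simp add: cC)
    next
      case False
      then show ?thesis using sub by (auto simp: cC cB)
    qed
  qed
  moreover have "?g ` A = (cB ` A) \<times> (cC ` B)"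
  proof
    show "?g ` A \<subseteq> (cB ` A) \<times> (cC ` B)" using \<rho>B by auto
    show "(cB ` A) \<times> (cC ` B) \<subseteq> ?g ` A"
    proof
      fix z assume "z \<in> (cB ` A) \<times> (cC ` B)"
      then obtain a b where ab: "a \<in> A" "b \<in> B" "z = (cB a, cC b)" by auto
      define x where "x = \<rho> a + b"
      have x: "x \<in> A" unfolding x_def using \<rho>[OF ab(1)] ab sub A by (auto intro: add_subgroup_add)
      have "cB x = cB (\<rho> a)" unfolding cB x_def using ab by simp
      then have e: "cB x = cB a" using \<rho>[OF ab(1)] by simp
      have "x - \<rho> x = b" using \<rho>_cong[OF e] unfolding x_def by simp
      then have "z = ?g x" using e ab by simp
      then show "z \<in> ?g ` A" using x by blast
    qed
  qed
  ultimately show ?thesis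
    by (simp add: quot_card_def carrier_quot_group card_cartesian_product cB_def cC_def)
qed

lemma quot_card_self:
  assumes "add_subgroup A"
  shows "quot_card A A = 1"
proof -
  have "(\<lambda>b. b + a) ` A = A" if "a \<in> A" for a
    using coset_eq_iff[OF assms, of a 0] that by simp
  then have "(\<lambda>a. (\<lambda>b. b + a) ` A) ` A = {A}"
    using add_subgroup_zero[OF assms] by auto
  then show ?thesis by (simp add: quot_card_def carrier_quot_group)
qed

lemma quot_card_pos_iff:
  assumes "add_subgroup A"
  shows "0 < quot_card A B \<longleftrightarrow> finite (carrier (quot_group A B))"
  using add_subgroup_zero[OF assms]
  by (auto simp: quot_card_def card_gt_0_iff carrier_quot_group)

lemma quot_card_ge:
  assumes A: "add_subgroup A" "add_subgroup B" and pos: "0 < quot_card A B"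
    and f: "\<And>i. i < n \<Longrightarrow> f i \<in> A" "\<And>i j. i < j \<Longrightarrow> j < n \<Longrightarrow> f j - f i \<notin> B"
  shows "(n::nat) \<le> quot_card A B"
proof -
  let ?g = "\<lambda>i. (\<lambda>b. b + f i) ` B"
  have "inj_on ?g {..<n}"
  proof (rule inj_onI)
    fix i j assume ij: "i \<in> {..<n}" "j \<in> {..<n}" and eq: "?g i = ?g j"
    have "f i - f j \<in> B" "f j - f i \<in> B"
      using eq coset_eq_iff[OF A(2)] by blast+
    then show "i = j" using f(2)[of i j] f(2)[of j i] ij by (cases i j rule: linorder_cases) auto
  qed
  moreover have "?g ` {..<n} \<subseteq> carrier (quot_group A B)"
    using f by (auto simp: carrier_quot_group)
  ultimately have "card {..<n} \<le> card (carrier (quot_group A B))"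
    using pos quot_card_pos_iff[OF A(1)] by (metis card_inj_on_le)
  then show ?thesis by (simp add: quot_card_def)
qed

lemma quot_card_le:
  assumes A: "add_subgroup A" "add_subgroup B" and S: "finite S"
    and g: "\<And>x. x \<in> A \<Longrightarrow> g x \<in> S" "\<And>x y. x \<in> A \<Longrightarrow> y \<in> A \<Longrightarrow> g x = g y \<Longrightarrow> x - y \<in> B"
  shows "0 < quot_card A B" "quot_card A B \<le> card S"
proof -
  let ?C = "carrier (quot_group A B)"
  let ?r = "inv_into A (\<lambda>a. (\<lambda>b. b + a) ` B)"
  have r: "?r c \<in> A \<and> (\<lambda>b. b + ?r c) ` B = c" if "c \<in> ?C" for c
    using that inv_into_into[of c "\<lambda>a. (\<lambda>b. b + a) ` B" A]
      f_inv_into_f[of c "\<lambda>a. (\<lambda>b. b + a) ` B" A] unfolding carrier_quot_group by simp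
  have inj: "inj_on (\<lambda>c. g (?r c)) ?C"
  proof (rule inj_onI)
    fix c d assume cd: "c \<in> ?C" "d \<in> ?C" "g (?r c) = g (?r d)"
    then have "?r c - ?r d \<in> B" using r g(2) by blast
    then show "c = d" using r[OF cd(1)] r[OF cd(2)] coset_eq_iff[OF A(2), of "?r c" "?r d"] by simp
  qed
  have sub: "(\<lambda>c. g (?r c)) ` ?C \<subseteq> S" using r g(1) by auto
  have fin: "finite ?C" using inj sub S by (metis finite_imageD finite_subset)
  then show "0 < quot_card A B" using quot_card_pos_iff[OF A(1)] by simp
  show "quot_card A B \<le> card S"
    unfolding quot_card_def using card_inj_on_le[OF inj sub S] .
qed

lemma quot_card_one_imp_eq:
  assumes A: "add_subgroup A" "add_subgroup B" "B \<subseteq> A" and one: "quot_card A B = 1"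
  shows "A = B"
proof (rule ccontr)
  assume "A \<noteq> B"
  then obtain x where x: "x \<in> A" "x \<notin> B" using A by blast
  have "(2::nat) \<le> quot_card A B"
    by (rule quot_card_ge[where f = "\<lambda>i. if i = 0 then 0 else x"])
      (use A x one in \<open>auto simp: add_subgroup_zero\<close>)
  then show False using one by simp
qed

text \<open>The intermediate group \<open>?P\<close> consists of the elements of A that agree with
  an element of B up to the kernel of \<open>h\<close>. The quotient of A by \<open>?P\<close> is
  the quotient of images, and \<open>?P\<close> modulo B is the quotient of kernels.\<close>

lemma quot_card_image_kernel:
  fixes h :: "'a::ab_group_add \<Rightarrow> 'b::ab_group_add"
  assumes A: "add_subgroup A" "add_subgroup B" "B \<subseteq> A"
    and h: "\<And>x y. h (x - y) = h x - h y"
  shows "quot_card A B = quot_card (h ` A) (h ` B) * quot_card {x \<in> A. h x = 0} {x \<in> B. h x = 0}"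
proof -
  let ?P = "{a \<in> A. h a \<in> h ` B}"
  have z: "add_subgroup {0::'b}" by (simp add: add_subgroup_def)
  have hB: "add_subgroup (h ` B)" using A h by (intro add_subgroup_image)
  have P: "add_subgroup ?P" using A h hB by (intro add_subgroup_preimage)
  have kA: "add_subgroup {x \<in> A. h x = 0}" "add_subgroup {x \<in> B. h x = 0}"
    using add_subgroup_preimage[OF A(1) z h] add_subgroup_preimage[OF A(2) z h] by simp_all
  have "quot_card A ?P = quot_card (h ` A) (h ` B)"
    by (rule quot_card_iso[where h = h])
      (use A hB P h add_subgroup_zero[OF hB] in \<open>auto intro!: bexI\<close>)
  moreover have "quot_card {x \<in> A. h x = 0} {x \<in> B. h x = 0} = quot_card ?P B"
  proof (rule quot_card_iso[where h = "\<lambda>x. x"])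
    fix y assume "y \<in> ?P"
    then obtain b where b: "y \<in> A" "b \<in> B" "h y = h b" by auto
    then have "y - b \<in> {x \<in> A. h x = 0}" "y - (y - b) \<in> B"
      using A h add_subgroup_diff[OF A(1)] by auto
    then show "\<exists>x\<in>{x \<in> A. h x = 0}. y - x \<in> B" by blast
  next
    fix x assume "x \<in> {x \<in> A. h x = 0}"
    then show "x \<in> ?P"
      using add_subgroup_zero[OF hB] by auto
  qed (use A kA in auto)
  moreover have "quot_card A B = quot_card A ?P * quot_card ?P B"
    by (rule quot_card_mult) (use A P in auto)
  ultimately show ?thesis by simp
qed

lemma quot_card_inj_image:
  fixes h :: "'a::ab_group_add \<Rightarrow> 'b::ab_group_add"
  assumes "add_subgroup A" "add_subgroup B" "B \<subseteq> A"
    and h: "\<And>x y. h (x - y) = h x - h y" and inj: "\<And>x. x \<in> A \<Longrightarrow> h x = 0 \<Longrightarrow> x = 0"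
  shows "quot_card (h ` A) (h ` B) = quot_card A B"
proof -
  have "h 0 = 0" using h[of 0 0] by simp
  then have "{x \<in> A. h x = 0} = {0}" "{x \<in> B. h x = 0} = {0}"
    using assms inj add_subgroup_zero by blast+
  moreover have "quot_card {0::'a} {0} = 1" by (rule quot_card_self) (simp add: add_subgroup_def)
  ultimately show ?thesis using quot_card_image_kernel[OF assms(1-3) h] by simp
qed

text \<open>The index of \<open>h\<close>
  B\<open>in A is computed once through B and once through\<close>h \<open>A\<close>. Injectivity
  gives \<open>h\<close> A\<open>over\<close>h \<open>B\<close> the same index as A over B, and this
  finite factor cancels.\<close>

lemma quot_card_endo_commensurable:
  fixes h :: "'a::ab_group_add \<Rightarrow> 'a"
  assumes A: "add_subgroup A" "add_subgroup B" "B \<subseteq> A" and fin: "0 < quot_card A B"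
    and h: "\<And>x y. h (x - y) = h x - h y" and inj: "\<And>x. x \<in> A \<Longrightarrow> h x = 0 \<Longrightarrow> x = 0"
    and stable: "h ` A \<subseteq> A" "h ` B \<subseteq> B"
  shows "quot_card A (h ` A) = quot_card B (h ` B)"
proof -
  have hAB: "add_subgroup (h ` A)" "add_subgroup (h ` B)"
    using A h by (auto intro: add_subgroup_image)
  have "quot_card A B * quot_card B (h ` B) = quot_card A (h ` B)"
    by (rule quot_card_mult[symmetric]) (use A hAB stable in auto)
  also have "\<dots> = quot_card A (h ` A) * quot_card (h ` A) (h ` B)"
    by (rule quot_card_mult) (use A hAB stable in auto)
  also have "quot_card (h ` A) (h ` B) = quot_card A B"
    by (rule quot_card_inj_image) (use A h inj in auto)
  finally show ?thesis using fin by simp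
qed

section \<open>Radicals of pairings modulo the integers\<close>

definition biadditive :: "('v::ab_group_add \<Rightarrow> 'v \<Rightarrow> rat) \<Rightarrow> bool" where
  "biadditive \<beta> \<longleftrightarrow> (\<forall>x y z. \<beta> (x - y) z = \<beta> x z - \<beta> y z) \<and> (\<forall>x y z. \<beta> x (y - z) = \<beta> x y - \<beta> x z)"

text \<open>Only the left radical gets a name; the right one is the radical of the form with swapped
  arguments.\<close>

definition radical :: "('v::ab_group_add \<Rightarrow> 'v \<Rightarrow> rat) \<Rightarrow> 'v set \<Rightarrow> 'v set \<Rightarrow> 'v set" where
  "radical \<beta> L M = {x \<in> L. \<forall>y\<in>M. \<beta> x y \<in> \<int>}"

lemma biadditive_diff:
  assumes "biadditive \<beta>"
  shows "\<beta> (x - y) z = \<beta> x z - \<beta> y z" "\<beta> x (y - z) = \<beta> x y - \<beta> x z"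
  using assms unfolding biadditive_def by blast+

lemma biadditive_zero:
  assumes "biadditive \<beta>"
  shows "\<beta> 0 z = 0" "\<beta> z 0 = 0"
  using biadditive_diff[OF assms, of 0 0 z] biadditive_diff[OF assms, of z 0 0] by simp_all

lemma biadditive_uminus:
  assumes "biadditive \<beta>"
  shows "\<beta> (- x) z = - \<beta> x z" "\<beta> x (- z) = - \<beta> x z"
  using biadditive_diff(1)[OF assms, of 0 x z] biadditive_diff(2)[OF assms, of x 0 z]
    biadditive_zero[OF assms] by simp_all

lemma biadditive_add:
  assumes "biadditive \<beta>"
  shows "\<beta> (x + y) z = \<beta> x z + \<beta> y z" "\<beta> x (y + z) = \<beta> x y + \<beta> x z"
  using biadditive_diff(1)[OF assms, of x "- y" z] biadditive_diff(2)[OF assms, of x y "- z"]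
    biadditive_uminus[OF assms] by simp_all

lemma biadditive_swap: "biadditive \<beta> \<Longrightarrow> biadditive (\<lambda>x y. \<beta> y x)"
  by (simp add: biadditive_def)

lemma add_subgroup_radical:
  assumes "biadditive \<beta>" "add_subgroup L"
  shows "add_subgroup (radical \<beta> L M)"
  using assms unfolding add_subgroup_def radical_def
  by (auto simp: biadditive_zero biadditive_diff)

lemma radical_subset: "radical \<beta> L M \<subseteq> L"
  by (auto simp: radical_def)

locale rat_space = vector_space scale
  for scale :: "rat \<Rightarrow> 'v::ab_group_add \<Rightarrow> 'v"
begin

lemma add_subgroup_scale_nat:
  assumes "add_subgroup A" "x \<in> A"
  shows "scale (of_nat n) x \<in> A"
  by (induction n) (use assms in \<open>auto simp: scale_left_distrib intro: add_subgroup_add add_subgroup_zero\<close>)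

lemma add_subgroup_scale_int:
  assumes "add_subgroup A" "x \<in> A"
  shows "scale (of_int k) x \<in> A"
  using add_subgroup_scale_nat[OF assms] add_subgroup_uminus[OF assms(1)]
  by (cases k rule: int_cases2) (auto simp: scale_minus_left)

lemma biadditive_scale_nat:
  fixes \<beta> :: "'v \<Rightarrow> 'v \<Rightarrow> rat"
  assumes "biadditive \<beta>"
  shows "\<beta> (scale (of_nat n) x) y = of_nat n * \<beta> x y" "\<beta> x (scale (of_nat n) y) = of_nat n * \<beta> x y"
  by (induction n) (auto simp: scale_left_distrib biadditive_add[OF assms] biadditive_zero[OF assms] algebra_simps)

text \<open>Pigeonhole: otherwise the multiples of \<open>x\<close> by 0 up to the index would lie
  in pairwise distinct cosets.\<close>

lemma multiple_in_finite_index: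
  assumes A: "add_subgroup A" "add_subgroup B" and fin: "0 < quot_card A B" and x: "x \<in> A"
  obtains n :: nat where "n > 0" "scale (of_nat n) x \<in> B"
proof -
  have "\<exists>n>0. scale (of_nat n) x \<in> B"
  proof (rule ccontr)
    assume *: "\<not> (\<exists>n>0. scale (of_nat n) x \<in> B)"
    have "quot_card A B + 1 \<le> quot_card A B"
    proof (rule quot_card_ge[where f = "\<lambda>i. scale (of_nat i) x"])
      fix i j :: nat assume "i < j"
      then have "scale (of_nat j) x - scale (of_nat i) x = scale (of_nat (j - i)) x"
        by (simp add: scale_left_diff_distrib of_nat_diff)
      then show "scale (of_nat j) x - scale (of_nat i) x \<notin> B" using * \<open>i < j\<close> by (metis zero_less_diff)
    qed (use A fin x add_subgroup_scale_nat in auto)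
    then show False by simp
  qed
  then show thesis using that by blast
qed

text \<open>One half of the duality of finite abelian groups, without characters. An element
  \<open>x\<close> of order n modulo the left radical cuts M down to the subgroup \<open>M1\<close>
  orthogonal to it. Passing to \<open>M1\<close> costs an index of at most n in M, while the left
  radical grows by a factor of at least n, so the claim for \<open>M1\<close> gives the claim for
  M.\<close>

lemma quot_card_radical_le:
  fixes \<beta> :: "'v \<Rightarrow> 'v \<Rightarrow> rat"
  assumes \<beta>: "biadditive \<beta>" and L: "add_subgroup L" and M: "add_subgroup M"
    and fin: "0 < quot_card L (radical \<beta> L M)"
  shows "0 < quot_card M (radical (\<lambda>x y. \<beta> y x) M L) \<and>
    quot_card M (radical (\<lambda>x y. \<beta> y x) M L) \<le> quot_card L (radical \<beta> L M)"
  using M fin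
proof (induction "quot_card L (radical \<beta> L M)" arbitrary: M rule: less_induct)
  case less
  let ?R = "radical \<beta> L M" and ?S = "radical (\<lambda>x y. \<beta> y x) M L"
  note M = less.prems(1)
  have R: "add_subgroup ?R" by (rule add_subgroup_radical[OF \<beta> L])
  have S: "add_subgroup ?S" by (rule add_subgroup_radical[OF biadditive_swap[OF \<beta>] M])
  show ?case
  proof (cases "?R = L")
    case True
    then have "?S = M" by (auto simp: radical_def)
    then show ?thesis using True less.prems quot_card_self[OF M] by simp
  next
    case False
    then obtain x where x: "x \<in> L" "x \<notin> ?R" by (auto simp: radical_def)
    \<comment> \<open>This is the order of \<open>x\<close> modulo the left radical.\<close>
    define n where "n = (LEAST n. n > 0 \<and> scale (of_nat n) x \<in> ?R)"
    obtain n0 :: nat where "n0 > 0" "scale (of_nat n0) x \<in> ?R"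
      using multiple_in_finite_index[OF L R less.prems(2) x(1)] by blast
    then have n: "n > 0" "scale (of_nat n) x \<in> ?R"
      unfolding n_def using LeastI[of "\<lambda>n. n > 0 \<and> scale (of_nat n) x \<in> ?R" n0] by auto
    have n_least: "scale (of_nat m) x \<notin> ?R" if "0 < m" "m < n" for m
      using that not_less_Least unfolding n_def by blast
    define M1 where "M1 = {y \<in> M. \<beta> x y \<in> \<int>}"
    have M1: "add_subgroup M1" using add_subgroup_radical[OF biadditive_swap[OF \<beta>] M, of "{x}"]
      by (simp add: M1_def radical_def)
    let ?R1 = "radical \<beta> L M1"
    have R1: "add_subgroup ?R1" by (rule add_subgroup_radical[OF \<beta> L])
    have sub: "?R \<subseteq> ?R1" "x \<in> ?R1" using x by (auto simp: radical_def M1_def)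
    \<comment> \<open>Elements of the right radical pair integrally with \<open>x\<close>, so they
      already lie in \<open>M1\<close> and nothing is lost.\<close>
    have S1: "radical (\<lambda>x y. \<beta> y x) M1 L = ?S" using x by (auto simp: radical_def M1_def)
    have LR: "quot_card L ?R = quot_card L ?R1 * quot_card ?R1 ?R"
      by (rule quot_card_mult) (use L R R1 sub radical_subset[of \<beta> L M1] in auto)
    then have pos: "0 < quot_card L ?R1" "0 < quot_card ?R1 ?R" using less.prems(2) by auto
    have ge: "n \<le> quot_card ?R1 ?R"
    proof (rule quot_card_ge[where f = "\<lambda>i. scale (of_nat i) x"])
      fix i j :: nat assume "i < j" "j < n"
      then have "scale (of_nat j) x - scale (of_nat i) x = scale (of_nat (j - i)) x"
        by (simp add: scale_left_diff_distrib of_nat_diff)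
      then show "scale (of_nat j) x - scale (of_nat i) x \<notin> ?R"
        using n_least[of "j - i"] \<open>i < j\<close> \<open>j < n\<close> by (simp del: of_nat_diff)
    qed (use R R1 pos sub add_subgroup_scale_nat in auto)
    have "n \<noteq> 1" using n x by auto
    then have "quot_card L ?R1 < quot_card L ?R" using LR pos ge n by simp
    from less.hyps[OF this M1 pos(1)]
    have IH: "0 < quot_card M1 ?S" "quot_card M1 ?S \<le> quot_card L ?R1" by (simp_all add: S1)
    have int: "of_nat n * \<beta> x y \<in> \<int>" if "y \<in> M" for y
      using n(2) that unfolding radical_def by (auto simp flip: biadditive_scale_nat(1)[OF \<beta>])
    \<comment> \<open>The value of the form at \<open>x\<close> and \<open>y\<close> lies in
      (1/n)\<int>; \<open>?g\<close> records its class modulo \<int> as a residue modulo n.\<close>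
    let ?g = "\<lambda>y. \<lfloor>of_nat n * \<beta> x y\<rfloor> mod int n"
    have diff: "y - z \<in> M1" if yz: "y \<in> M" "z \<in> M" "?g y = ?g z" for y z
    proof -
      obtain k where k: "\<lfloor>of_nat n * \<beta> x y\<rfloor> - \<lfloor>of_nat n * \<beta> x z\<rfloor> = int n * k"
        using yz(3) by (metis mod_eq_dvd_iff dvdE)
      have "of_nat n * \<beta> x y - of_nat n * \<beta> x z = of_int (int n * k)"
        unfolding k[symmetric] using int[OF yz(1)] int[OF yz(2)] by (simp add: of_int_floor)
      then have "of_nat n * (\<beta> x (y - z)) = of_nat n * of_int k"
        by (simp add: biadditive_diff[OF \<beta>] algebra_simps)
      then have "\<beta> x (y - z) = of_int k" using n by simp
      then show "y - z \<in> M1" using yz add_subgroup_diff[OF M] by (simp add: M1_def)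
    qed
    have le: "0 < quot_card M M1" "quot_card M M1 \<le> card {0..<int n}"
      using quot_card_le[OF M M1, of "{0..<int n}" ?g] diff n by auto
    have "quot_card M ?S = quot_card M M1 * quot_card M1 ?S"
      by (rule quot_card_mult) (use M M1 S in \<open>auto simp: radical_def M1_def x\<close>)
    moreover have "quot_card M M1 * quot_card M1 ?S \<le> quot_card ?R1 ?R * quot_card L ?R1"
      by (rule mult_le_mono) (use le ge IH in auto)
    ultimately show ?thesis using LR IH le by (simp add: mult.commute)
  qed
qed

lemma quot_card_radical:
  fixes \<beta> :: "'v \<Rightarrow> 'v \<Rightarrow> rat"
  assumes \<beta>: "biadditive \<beta>" and L: "add_subgroup L" and M: "add_subgroup M"
    and fin: "0 < quot_card L (radical \<beta> L M)"
  shows "quot_card M (radical (\<lambda>x y. \<beta> y x) M L) = quot_card L (radical \<beta> L M)"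
  using quot_card_radical_le[OF \<beta> L M fin] quot_card_radical_le[OF biadditive_swap[OF \<beta>] M L]
  by auto

text \<open>A hyperbolic pair is split off. For \<open>x\<close> outside the radical let
  \<open>L1\<close> be its orthogonal and \<open>R1\<close> the orthogonal of \<open>L1\<close>. By
  alternation \<open>x\<close> is in \<open>L1\<close>, hence \<open>R1\<close> is contained in
  \<open>L1\<close>. Duality makes the index of \<open>?R\<close> in \<open>R1\<close> equal to that
  of \<open>L1\<close> in L, so the full index is a square times the index of \<open>R1\<close> in
  \<open>L1\<close>, and \<open>R1\<close> is the radical of the form on \<open>L1\<close>.\<close>

lemma quot_card_alternating_is_square:
  fixes \<beta> :: "'v \<Rightarrow> 'v \<Rightarrow> rat"
  assumes \<beta>: "biadditive \<beta>" and L: "add_subgroup L"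
    and alt: "\<And>x. x \<in> L \<Longrightarrow> \<beta> x x \<in> \<int>"
    and fin: "0 < quot_card L (radical \<beta> L L)"
  shows "\<exists>s. s > 0 \<and> quot_card L (radical \<beta> L L) = s\<^sup>2"
  using L alt fin
proof (induction "quot_card L (radical \<beta> L L)" arbitrary: L rule: less_induct)
  case less
  note L = less.prems(1) and alt = less.prems(2) and fin = less.prems(3)
  let ?R = "radical \<beta> L L"
  have R: "add_subgroup ?R" by (rule add_subgroup_radical[OF \<beta> L])
  have skew: "\<beta> x y + \<beta> y x \<in> \<int>" if "x \<in> L" "y \<in> L" for x y
  proof -
    have "\<beta> (x + y) (x + y) - \<beta> x x - \<beta> y y \<in> \<int>"
      using that alt L by (intro Ints_diff) (auto intro: add_subgroup_add)
    then show ?thesis by (simp add: biadditive_add[OF \<beta>] algebra_simps)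
  qed
  have sym: "\<beta> y x \<in> \<int>" if "\<beta> x y \<in> \<int>" "x \<in> L" "y \<in> L" for x y
    using Ints_diff[OF skew[OF that(2,3)] that(1)] by simp
  show ?case
  proof (cases "?R = L")
    case True
    then show ?thesis using quot_card_self[OF L] by (intro exI[of _ 1]) simp
  next
    case False
    then obtain x where x: "x \<in> L" "x \<notin> ?R" by (auto simp: radical_def)
    define L1 where "L1 = radical (\<lambda>y x. \<beta> x y) L {x}"
    have L1_iff: "y \<in> L1 \<longleftrightarrow> y \<in> L \<and> \<beta> x y \<in> \<int>" for y by (simp add: L1_def radical_def)
    have L1: "add_subgroup L1"
      unfolding L1_def by (rule add_subgroup_radical[OF biadditive_swap[OF \<beta>] L])
    define R1 where "R1 = radical \<beta> L L1"
    have R1: "add_subgroup R1" unfolding R1_def by (rule add_subgroup_radical[OF \<beta> L])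
    have xL1: "x \<in> L1" using x alt by (simp add: L1_iff)
    have "R1 \<subseteq> L1" using xL1 sym x by (auto simp: R1_def radical_def L1_iff)
    then have R1_eq: "R1 = radical \<beta> L1 L1" by (auto simp: R1_def radical_def L1_iff)
    have sub: "?R \<subseteq> R1" "L1 \<subseteq> L" "R1 \<subseteq> L" by (auto simp: R1_def radical_def L1_iff)
    have right: "radical (\<lambda>x y. \<beta> y x) L1 L = ?R"
      using x sym unfolding radical_def L1_iff by blast
    have LR: "quot_card L ?R = quot_card L R1 * quot_card R1 ?R"
      "quot_card L ?R = quot_card L L1 * quot_card L1 ?R"
      "quot_card L1 ?R = quot_card L1 R1 * quot_card R1 ?R"
      by (rule quot_card_mult; use L R R1 L1 sub \<open>R1 \<subseteq> L1\<close> in auto)+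
    have pos: "0 < quot_card L R1" "0 < quot_card R1 ?R" "0 < quot_card L L1" "0 < quot_card L1 ?R"
      using fin LR(1,2) by (metis mult_is_0 neq0_conv)+
    \<comment> \<open>Duality for the pairing of L with \<open>L1\<close>, whose two radicals are
      \<open>R1\<close> and \<open>?R\<close>.\<close>
    have "quot_card L1 ?R = quot_card L R1"
      using quot_card_radical[OF \<beta> L L1] pos(1) by (simp add: right R1_def)
    then have eq: "quot_card R1 ?R = quot_card L L1" using LR pos by simp
    have "quot_card L L1 \<noteq> 1"
    proof
      assume "quot_card L L1 = 1"
      then have "L = L1" using quot_card_one_imp_eq[OF L L1 sub(2)] by simp
      then have "\<beta> x y \<in> \<int>" if "y \<in> L" for y using that L1_iff by blast
      then show False using x by (auto simp: radical_def)
    qed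
    then have two: "quot_card L L1 \<ge> 2" using pos by simp
    have whole: "quot_card L ?R = (quot_card L L1)\<^sup>2 * quot_card L1 R1"
      using LR eq by (simp add: power2_eq_square)
    have pos1: "0 < quot_card L1 R1" using LR pos by auto
    have "quot_card L L1 > 0" using two by simp
    have "1 < (quot_card L L1)\<^sup>2" using two one_less_power[of "quot_card L L1" 2] by simp
    then have "quot_card L1 R1 < quot_card L ?R" using whole pos1 by simp
    then obtain s where "s > 0" "quot_card L1 R1 = s\<^sup>2"
      using less.hyps[of L1] L1 alt pos1 by (auto simp: R1_eq L1_iff)
    then show ?thesis using whole \<open>quot_card L L1 > 0\<close>
      by (intro exI[of _ "quot_card L L1 * s"]) (simp add: power_mult_distrib)
  qed
qed

section \<open>Determinants as indices\<close>

text \<open>Families indexed by the numbers below \<open>n\<close> replace sets of vectors, so that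
  matrices act on coefficients and inductions on the rank can append a vector.\<close>

definition int_comb :: "(nat \<Rightarrow> 'v) \<Rightarrow> nat \<Rightarrow> (nat \<Rightarrow> int) \<Rightarrow> 'v" where
  "int_comb w n a = (\<Sum>i<n. scale (of_int (a i)) (w i))"

definition int_span :: "(nat \<Rightarrow> 'v) \<Rightarrow> nat \<Rightarrow> 'v set" where
  "int_span w n = range (int_comb w n)"

definition int_indep :: "(nat \<Rightarrow> 'v) \<Rightarrow> nat \<Rightarrow> bool" where
  "int_indep w n \<longleftrightarrow> (\<forall>a. int_comb w n a = 0 \<longrightarrow> (\<forall>i<n. a i = 0))"

lemma int_comb_Suc: "int_comb w (Suc n) a = int_comb w n a + scale (of_int (a n)) (w n)"
  by (simp add: int_comb_def)

lemma int_comb_cong: "(\<And>i. i < n \<Longrightarrow> a i = b i) \<Longrightarrow> (\<And>i. i < n \<Longrightarrow> w i = w' i) \<Longrightarrow> int_comb w n a = int_comb w' n b"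
  by (simp add: int_comb_def)

lemma int_comb_extend:
  "int_comb w (Suc n) (\<lambda>i. if i < n then a i else k) = int_comb w n a + scale (of_int k) (w n)"
  by (simp add: int_comb_def)

lemma int_comb_diff: "int_comb w n (\<lambda>i. a i - b i) = int_comb w n a - int_comb w n b"
  by (simp add: int_comb_def scale_left_diff_distrib sum_subtractf)

lemma int_comb_add: "int_comb w n (\<lambda>i. a i + b i) = int_comb w n a + int_comb w n b"
  by (simp add: int_comb_def scale_left_distrib sum.distrib)

lemma int_comb_scale: "int_comb w n (\<lambda>i. k * a i) = scale (of_int k) (int_comb w n a)"
  by (simp add: int_comb_def scale_sum_right)

lemma int_comb_zero: "int_comb w n (\<lambda>i. 0) = 0"
  by (simp add: int_comb_def)

lemma int_comb_unit:
  assumes "j < n"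
  shows "int_comb w n (\<lambda>i. if i = j then k else 0) = scale (of_int k) (w j)"
proof -
  have "int_comb w n (\<lambda>i. if i = j then k else 0)
      = (\<Sum>i<n. if i = j then scale (of_int k) (w j) else 0)"
    unfolding int_comb_def by (rule sum.cong) auto
  then show ?thesis using assms by simp
qed

lemma int_comb_matrix:
  "int_comb (\<lambda>j. int_comb w n (\<lambda>i. T i j)) m a = int_comb w n (\<lambda>i. \<Sum>j<m. T i j * a j)"
proof -
  have "int_comb (\<lambda>j. int_comb w n (\<lambda>i. T i j)) m a
      = (\<Sum>j<m. \<Sum>i<n. scale (of_int (T i j * a j)) (w i))"
    by (simp add: int_comb_def scale_sum_right mult.commute)
  also have "\<dots> = (\<Sum>i<n. \<Sum>j<m. scale (of_int (T i j * a j)) (w i))"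
    by (rule sum.swap)
  also have "\<dots> = int_comb w n (\<lambda>i. \<Sum>j<m. T i j * a j)"
    by (simp add: int_comb_def scale_sum_left)
  finally show ?thesis .
qed

lemma int_indepD:
  assumes "int_indep w n" "int_comb w n a = int_comb w n b" "i < n"
  shows "a i = b i"
proof -
  have "int_comb w n (\<lambda>i. a i - b i) = 0" using assms by (simp add: int_comb_diff)
  then show ?thesis using assms unfolding int_indep_def by fastforce
qed

lemma int_indep_SucD:
  assumes "int_indep w (Suc n)"
  shows "int_indep w n"
  unfolding int_indep_def
proof (intro allI impI)
  fix a i assume a: "int_comb w n a = 0" "i < n"
  have "int_comb w (Suc n) (\<lambda>i. if i < n then a i else 0) = int_comb w n a"
    by (simp add: int_comb_extend)
  then have "int_comb w (Suc n) (\<lambda>i. if i < n then a i else 0) = 0" using a by simp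
  then have "(if i < n then a i else 0) = 0" using assms a less_SucI unfolding int_indep_def by blast
  then show "a i = 0" using a by simp
qed

lemma add_subgroup_int_span: "add_subgroup (int_span w n)"
proof -
  have "0 \<in> int_span w n" using int_comb_zero[of w n] unfolding int_span_def by (metis rangeI)
  then show ?thesis unfolding add_subgroup_def int_span_def
    by (auto simp flip: int_comb_diff)
qed

lemma int_span_Suc: "int_span w (Suc n) = {y + scale (of_int k) (w n) | y k. y \<in> int_span w n}"
proof -
  have "y + scale (of_int k) (w n) \<in> int_span w (Suc n)" if y: "y \<in> int_span w n" for y k
  proof -
    obtain a where "y = int_comb w n a" using y by (auto simp: int_span_def)
    then have "y + scale (of_int k) (w n) = int_comb w (Suc n) (\<lambda>i. if i < n then a i else k)"
      by (simp add: int_comb_extend)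
    then show ?thesis by (simp add: int_span_def)
  qed
  moreover have "int_comb w (Suc n) a \<in> {y + scale (of_int k) (w n) | y k. y \<in> int_span w n}" for a
    unfolding int_comb_Suc int_span_def by blast
  ultimately show ?thesis unfolding int_span_def[of w "Suc n"] by auto
qed

lemma int_span_cong: "(\<And>i. i < n \<Longrightarrow> w i = w' i) \<Longrightarrow> int_span w n = int_span w' n"
  unfolding int_span_def by (intro image_cong int_comb_cong) auto

lemma int_span_base:
  assumes "j < n"
  shows "w j \<in> int_span w n"
proof -
  have "int_comb w n (\<lambda>i. if i = j then 1 else 0) = w j" by (simp add: int_comb_unit[OF assms])
  then show ?thesis
    unfolding int_span_def using rangeI[of "int_comb w n" "\<lambda>i. if i = j then 1 else 0"] by simp
qed

lemma additive_scale_int: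
  fixes G :: "'v \<Rightarrow> 'v"
  assumes G: "\<And>x y. G (x - y) = G x - G y"
  shows "G (scale (of_int k) x) = scale (of_int k) (G x)"
proof -
  have G0: "G 0 = 0" using G[of 0 0] by simp
  have Gm: "G (- x) = - G x" for x using G[of 0 x] G0 by simp
  have Gp: "G (x + y) = G x + G y" for x y using G[of x "- y"] Gm by simp
  have "G (scale (of_nat n) x) = scale (of_nat n) (G x)" for n
    by (induction n) (auto simp: G0 Gp scale_left_distrib)
  then show ?thesis by (cases k rule: int_cases2) (auto simp: Gm)
qed

lemma additive_int_comb:
  fixes G :: "'v \<Rightarrow> 'v"
  assumes G: "\<And>x y. G (x - y) = G x - G y"
  shows "G (int_comb w n a) = int_comb (\<lambda>i. G (w i)) n a"
proof -
  have G0: "G 0 = 0" using G[of 0 0] by simp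
  have Gm: "G (- x) = - G x" for x using G[of 0 x] G0 by simp
  have Gp: "G (x + y) = G x + G y" for x y using G[of x "- y"] Gm by simp
  show ?thesis
    by (induction n) (auto simp: int_comb_def G0 Gp additive_scale_int[OF G])
qed

text \<open>The last coordinates of elements of N form an ideal of \<int>, and \<open>a\<close> is
  chosen so that its last coordinate generates it. For the zero ideal the combination itself is
  taken to be 0; the proof of freeness then drops that vector.\<close>

lemma subgroup_of_int_span_Suc:
  assumes w: "int_indep w (Suc n)" and N: "add_subgroup N" "N \<subseteq> int_span w (Suc n)"
  obtains a where "a n \<ge> 0" "a n = 0 \<Longrightarrow> int_comb w (Suc n) a = 0"
    "N = {y + scale (of_int k) (int_comb w (Suc n) a) | y k. y \<in> N \<inter> int_span w n}"
proof -
  define I where "I = {a n | a. int_comb w (Suc n) a \<in> N}"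
  have in_span: "int_comb w (Suc n) b \<in> int_span w n" if "b n = 0" for b
    using that by (simp add: int_comb_Suc int_span_def)
  show thesis
  proof (cases "I \<subseteq> {0}")
    case True
    have "N \<subseteq> int_span w n"
    proof
      fix y assume y: "y \<in> N"
      then obtain b where b: "y = int_comb w (Suc n) b" using N by (auto simp: int_span_def)
      then have "b n = 0" using True y unfolding I_def by auto
      then show "y \<in> int_span w n" using in_span b by simp
    qed
    then have "N = {y + scale (of_int k) (int_comb w (Suc n) (\<lambda>_. 0)) | y k. y \<in> N \<inter> int_span w n}"
      by (auto simp: int_comb_zero)
    then show thesis using that[of "\<lambda>_. 0"] by (simp add: int_comb_zero)
  next
    case False
    define P where "P m \<longleftrightarrow> m > 0 \<and> int m \<in> I" for m :: nat
    have neg: "- m \<in> I" if "m \<in> I" for m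
    proof -
      obtain b where b: "m = b n" "int_comb w (Suc n) b \<in> N" using \<open>m \<in> I\<close> unfolding I_def by auto
      have "int_comb w (Suc n) (\<lambda>i. - b i) = - int_comb w (Suc n) b"
        using int_comb_scale[of w "Suc n" "-1" b] by simp
      then have "int_comb w (Suc n) (\<lambda>i. - b i) \<in> N" using b N by (simp add: add_subgroup_uminus)
      then show ?thesis unfolding I_def b(1) by (auto intro!: exI[of _ "\<lambda>i. - b i"])
    qed
    obtain m where m: "m \<in> I" "m \<noteq> 0" using False by auto
    then have "P (nat \<bar>m\<bar>)" using neg[of m] unfolding P_def by (auto simp: abs_if)
    then have PL: "P (LEAST m. P m)" by (rule LeastI)
    then obtain a where a: "a n = int (LEAST m. P m)" "int_comb w (Suc n) a \<in> N" "a n > 0"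
      unfolding P_def I_def by auto
    let ?x = "int_comb w (Suc n) a"
    have "N = {y + scale (of_int k) ?x | y k. y \<in> N \<inter> int_span w n}"
    proof (intro subset_antisym subsetI)
      fix y assume y: "y \<in> N"
      then obtain b where b: "y = int_comb w (Suc n) b" using N by (auto simp: int_span_def)
      \<comment> \<open>Division with remainder: a nonzero remainder would be a positive element of
        the ideal below its least one.\<close>
      define k where "k = b n div a n"
      define b' where "b' = (\<lambda>i. b i - k * a i)"
      have b'_eq: "int_comb w (Suc n) b' = y - scale (of_int k) ?x"
        unfolding b'_def int_comb_diff int_comb_scale b ..
      then have b'N: "int_comb w (Suc n) b' \<in> N"
        using y a(2) N by (simp add: add_subgroup_diff add_subgroup_scale_int)
      have "b' n = b n mod a n" unfolding b'_def k_def by (simp add: minus_div_mult_eq_mod)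
      then have b'n: "0 \<le> b' n" "b' n < a n" using a(3) by simp_all
      have "b' n = 0"
      proof (rule ccontr)
        assume "b' n \<noteq> 0"
        then have "P (nat (b' n))" using b'n b'N unfolding P_def I_def by auto
        then have "(LEAST m. P m) \<le> nat (b' n)" by (rule Least_le)
        then show False using a(1) b'n by linarith
      qed
      then have "y - scale (of_int k) ?x \<in> N \<inter> int_span w n" using in_span[of b'] b'_eq b'N by simp
      moreover have "y = (y - scale (of_int k) ?x) + scale (of_int k) ?x" by simp
      ultimately show "y \<in> {y + scale (of_int k) ?x | y k. y \<in> N \<inter> int_span w n}" by blast
    next
      fix y assume "y \<in> {y + scale (of_int k) ?x | y k. y \<in> N \<inter> int_span w n}"
      then show "y \<in> N" using a(2) N by (auto intro!: add_subgroup_add add_subgroup_scale_int)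
    qed
    then show thesis using that[of a] a by auto
  qed
qed

text \<open>The case \<open>c = 0\<close> is included: the quotient is then infinite and has
  \<open>card\<close> 0.\<close>

lemma quot_card_multiples:
  assumes "c \<ge> 0"
  shows "quot_card (UNIV :: int set) {k. c dvd k} = nat c"
proof -
  have B: "add_subgroup {k. c dvd k}" by (simp add: add_subgroup_def)
  have "quot_card (UNIV :: int set) {k. c dvd k} = card ((\<lambda>k. k mod c) ` UNIV)"
    unfolding quot_card_def carrier_quot_group
    by (rule card_image_cong_fibres) (simp add: coset_eq_iff[OF B] mod_eq_dvd_iff)
  also have "\<dots> = nat c"
  proof (cases "c = 0")
    case True
    then show ?thesis by (simp add: infinite_UNIV_int)
  next
    case False
    then have "c > 0" using assms by simp
    have "(\<lambda>k. k mod c) ` UNIV = {0..<c}"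
    proof
      show "(\<lambda>k. k mod c) ` UNIV \<subseteq> {0..<c}" using \<open>c > 0\<close> by auto
      show "{0..<c} \<subseteq> (\<lambda>k. k mod c) ` UNIV"
      proof
        fix k assume "k \<in> {0..<c}"
        then have "k = k mod c" by simp
        then show "k \<in> (\<lambda>k. k mod c) ` UNIV" by blast
      qed
    qed
    then show ?thesis by simp
  qed
  finally show ?thesis .
qed

text \<open>If \<open>N\<close> has infinite index, then both sides are \<open>0\<close>, as \<open>card\<close> is \<open>0\<close> on infinite sets.\<close>
lemma quot_card_int_span_Suc:
  assumes w: "int_indep w (Suc n)" and N: "add_subgroup N" "N \<subseteq> int_span w (Suc n)"
    and a: "a n \<ge> 0"
    and N_eq: "N = {y + scale (of_int k) (int_comb w (Suc n) a) | y k. y \<in> N \<inter> int_span w n}"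
  shows "quot_card (int_span w (Suc n)) N = nat (a n) * quot_card (int_span w n) (N \<inter> int_span w n)"
proof -
  let ?x = "int_comb w (Suc n) a" and ?W = "int_span w n"
  have W: "add_subgroup ?W" "add_subgroup (int_span w (Suc n))" by (rule add_subgroup_int_span)+
  have NW: "add_subgroup (N \<inter> ?W)" using N W by (simp add: add_subgroup_Int)
  \<comment> \<open>Through \<open>P\<close> the index splits into a contribution of the last
    coordinate, namely \<int> modulo \<open>a n\<close>, and the index one rank lower.\<close>
  define P where "P = ?W + N"
  have P: "add_subgroup P" unfolding P_def using W N by (simp add: add_subgroup_plus)
  have WS: "?W \<subseteq> int_span w (Suc n)"
    unfolding int_span_Suc by (force intro: exI[of _ 0])
  have sub: "N \<subseteq> P" "?W \<subseteq> P" "P \<subseteq> int_span w (Suc n)"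
    unfolding P_def using W N WS
    by (auto simp: add_subgroup_zero set_plus_def intro: add_subgroup_add)
      (metis add.left_neutral add_subgroup_zero, metis add.right_neutral add_subgroup_zero)
  have xN: "?x \<in> N"
  proof -
    have "0 + scale (of_int 1) ?x \<in> {y + scale (of_int k) ?x | y k. y \<in> N \<inter> ?W}"
      using add_subgroup_zero[OF NW] by blast
    then show ?thesis using N_eq by (metis (no_types, lifting) add_0 of_int_1 scale_one)
  qed
  have "quot_card (int_span w (Suc n)) N = quot_card (int_span w (Suc n)) P * quot_card P N"
    by (rule quot_card_mult) (use W N P sub in auto)
  moreover have "quot_card ?W (N \<inter> ?W) = quot_card P N"
  proof (rule quot_card_iso[where h = "\<lambda>x. x"])
    fix y assume "y \<in> P"
    then obtain u v where "u \<in> ?W" "v \<in> N" "y = u + v" unfolding P_def by (auto elim: set_plus_elim)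
    then show "\<exists>x\<in>?W. y - x \<in> N" by (intro bexI[of _ u]) auto
  qed (use W N NW sub in auto)
  moreover have "quot_card (UNIV :: int set) {k. a n dvd k} = quot_card (int_span w (Suc n)) P"
  proof (rule quot_card_iso[where h = "\<lambda>k. scale (of_int k) (w n)"])
    fix y assume "y \<in> int_span w (Suc n)"
    then obtain z k where "z \<in> ?W" "y = z + scale (of_int k) (w n)"
      unfolding int_span_Suc by blast
    then show "\<exists>k\<in>UNIV. y - scale (of_int k) (w n) \<in> P"
      using sub by (intro bexI[of _ k]) auto
  next
    fix k :: int
    have "0 + scale (of_int k) (w n) \<in> int_span w (Suc n)"
      unfolding int_span_Suc using add_subgroup_zero[OF W(1)] by blast
    then show "scale (of_int k) (w n) \<in> int_span w (Suc n)" by simp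
    have x_eq: "?x - int_comb w n a = scale (of_int (a n)) (w n)" by (simp add: int_comb_Suc)
    have aW: "int_comb w n a \<in> ?W" by (simp add: int_span_def)
    have "scale (of_int (a n)) (w n) \<in> P"
      unfolding x_eq[symmetric] using xN aW sub P by (auto intro: add_subgroup_diff)
    then have "scale (of_int l) (scale (of_int (a n)) (w n)) \<in> P" for l
      using P by (rule add_subgroup_scale_int[rotated])
    then have 1: "scale (of_int k) (w n) \<in> P" if "a n dvd k"
      using that by (auto elim!: dvdE simp: mult.commute)
    have 2: "a n dvd k" if kP: "scale (of_int k) (w n) \<in> P"
    proof -
      obtain u v where uv: "u \<in> ?W" "v \<in> N" "scale (of_int k) (w n) = u + v"
        using kP unfolding P_def by (auto elim: set_plus_elim)
      obtain y l where "v = y + scale (of_int l) ?x" "y \<in> ?W" using uv(2) N_eq by blast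
      then have "scale (of_int k) (w n) = (u + y) + scale (of_int l) ?x" "u + y \<in> ?W"
        using uv W by (auto simp: add.assoc intro: add_subgroup_add)
      then obtain b where b: "scale (of_int k) (w n) = int_comb w n b + scale (of_int l) ?x"
        by (auto simp: int_span_def)
      have "int_comb w (Suc n) (\<lambda>i. if i = n then k else 0) = scale (of_int k) (w n)"
        by (rule int_comb_unit) simp
      also have "\<dots> = int_comb w (Suc n) (\<lambda>i. (if i < n then b i else 0) + l * a i)"
        unfolding int_comb_add int_comb_scale b
        by (simp add: int_comb_extend)
      finally have "(if n = n then k else 0) = (if n < n then b n else 0) + l * a n"
        by (rule int_indepD[OF w]) simp
      then have "k = l * a n" by simp
      then show ?thesis by simp
    qed
    show "k \<in> {k. a n dvd k} \<longleftrightarrow> scale (of_int k) (w n) \<in> P" using 1 2 by blast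
  qed (use P in \<open>auto simp: add_subgroup_def scale_left_diff_distrib\<close>)
  ultimately show ?thesis using quot_card_multiples[OF a] by simp
qed

text \<open>Induction on the rank: \<open>subgroup_of_int_span_Suc\<close> supplies the last column,
  and \<open>quot_card_int_span_Suc\<close> multiplies the index by its diagonal entry. The diagonal
  may contain 0, which corresponds to infinite index.\<close>

lemma hermite_normal_form:
  assumes "int_indep w n" "add_subgroup N" "N \<subseteq> int_span w n"
  shows "\<exists>T. (\<forall>i j. j < i \<longrightarrow> T i j = 0) \<and> (\<forall>j. T j j \<ge> 0) \<and>
    N = int_span (\<lambda>j. int_comb w n (\<lambda>i. T i j)) n \<and>
    quot_card (int_span w n) N = nat (\<Prod>j<n. T j j)"
  using assms
proof (induction n arbitrary: N)
  case 0
  have z: "int_span u 0 = {0}" for u by (auto simp: int_span_def int_comb_def)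
  then have N: "N = {0}" using 0 add_subgroup_zero by auto
  have "quot_card {0::'v} {0} = 1" by (rule quot_card_self) (simp add: add_subgroup_def)
  then show ?case by (intro exI[of _ "\<lambda>_ _. 0"]) (simp add: z N)
next
  case (Suc n)
  obtain a where a: "a n \<ge> 0"
    "N = {y + scale (of_int k) (int_comb w (Suc n) a) | y k. y \<in> N \<inter> int_span w n}"
    using subgroup_of_int_span_Suc[OF Suc.prems] by blast
  have "add_subgroup (N \<inter> int_span w n)"
    using Suc.prems(2) by (simp add: add_subgroup_Int add_subgroup_int_span)
  from Suc.IH[OF int_indep_SucD[OF Suc.prems(1)] this] obtain T0 where
    T0: "\<forall>i j. j < i \<longrightarrow> T0 i j = 0" "\<forall>j. T0 j j \<ge> 0"
      "N \<inter> int_span w n = int_span (\<lambda>j. int_comb w n (\<lambda>i. T0 i j)) n"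
      "quot_card (int_span w n) (N \<inter> int_span w n) = nat (\<Prod>j<n. T0 j j)"
    using Int_lower2 by blast
  \<comment> \<open>The bound \<open>i \<le> n\<close> cuts off the irrelevant values of
    \<open>a\<close>, so that triangularity holds for all pairs of indices.\<close>
  define T where "T i j = (if j < n then T0 i j else if j = n \<and> i \<le> n then a i else 0)" for i j
  let ?u = "\<lambda>j. int_comb w (Suc n) (\<lambda>i. T i j)"
  have u: "?u j = int_comb w n (\<lambda>i. T0 i j)" if "j < n" for j
    using that T0(1) by (simp add: T_def int_comb_Suc)
  have un: "?u n = int_comb w (Suc n) a"
    by (rule int_comb_cong) (auto simp: T_def)
  have "int_span ?u n = N \<inter> int_span w n"
    unfolding T0(3) by (rule int_span_cong) (rule u)
  then have "int_span ?u (Suc n) = N"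
    unfolding int_span_Suc un using a(2) by simp
  moreover have "quot_card (int_span w (Suc n)) N = nat (\<Prod>j<Suc n. T j j)"
  proof -
    have "(\<Prod>j<n. T j j) = (\<Prod>j<n. T0 j j)" by (rule prod.cong) (auto simp: T_def)
    moreover have "(\<Prod>j<n. T0 j j) \<ge> 0" using T0(2) by (simp add: prod_nonneg)
    ultimately show ?thesis
      unfolding quot_card_int_span_Suc[OF Suc.prems a] T0(4) using a(1)
      by (simp add: T_def nat_mult_distrib mult.commute)
  qed
  moreover have "\<forall>i j. j < i \<longrightarrow> T i j = 0" "\<forall>j. T j j \<ge> 0" using T0 a by (auto simp: T_def)
  ultimately show ?case by (intro exI[of _ T]) simp
qed

text \<open>The same induction as for the Hermite form, except that a vector is appended only when
  its last coordinate is nonzero. The generators stay independent, and their number may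
  drop.\<close>

lemma subgroup_of_int_span_is_free:
  assumes "int_indep w n" "add_subgroup N" "N \<subseteq> int_span w n"
  shows "\<exists>u k. int_indep u k \<and> N = int_span u k"
  using assms
proof (induction n arbitrary: N)
  case 0
  have "int_span u 0 = {0}" for u by (auto simp: int_span_def int_comb_def)
  then show ?case using 0 add_subgroup_zero
    by (intro exI[of _ "\<lambda>_. 0"] exI[of _ 0]) (auto simp: int_indep_def)
next
  case (Suc n)
  obtain a where a: "a n \<ge> 0" "a n = 0 \<Longrightarrow> int_comb w (Suc n) a = 0"
    "N = {y + scale (of_int k) (int_comb w (Suc n) a) | y k. y \<in> N \<inter> int_span w n}"
    using subgroup_of_int_span_Suc[OF Suc.prems] by blast
  let ?x = "int_comb w (Suc n) a"
  have "add_subgroup (N \<inter> int_span w n)"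
    using Suc.prems(2) by (simp add: add_subgroup_Int add_subgroup_int_span)
  from Suc.IH[OF int_indep_SucD[OF Suc.prems(1)] this] obtain u k where
    u: "int_indep u k" "N \<inter> int_span w n = int_span u k" by auto
  show ?case
  proof (cases "a n = 0")
    case True
    then have "?x = 0" by (rule a(2))
    then have "N = N \<inter> int_span w n" using a(3) by auto
    then show ?thesis using u by metis
  next
    case False
    let ?v = "u(k := ?x)"
    have span_v: "int_span ?v k = int_span u k" by (rule int_span_cong) simp
    have comb_v: "int_comb ?v k b = int_comb u k b" for b by (rule int_comb_cong) auto
    have "int_span ?v (Suc k) = N"
      unfolding int_span_Suc span_v u(2)[symmetric] using a(3) by simp
    moreover have "int_indep ?v (Suc k)"
      unfolding int_indep_def
    proof (intro allI impI)
      fix b i assume b: "int_comb ?v (Suc k) b = 0" and i: "i < Suc k"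
      have 0: "int_comb u k b + scale (of_int (b k)) ?x = 0"
        using b unfolding int_comb_Suc[of ?v] comb_v by simp
      have "int_comb u k b \<in> int_span w n" using u(2) by (auto simp: int_span_def)
      then obtain c where c: "int_comb u k b = int_comb w n c" by (auto simp: int_span_def)
      have "int_comb w (Suc n) (\<lambda>i. (if i < n then c i else 0) + b k * a i) = 0"
        unfolding int_comb_add int_comb_scale
        using 0 c by (simp add: int_comb_extend)
      then have "(if n < n then c n else 0) + b k * a n = 0"
        using Suc.prems(1) unfolding int_indep_def by blast
      then have bk: "b k = 0" using False by simp
      then have "int_comb u k b = 0" using 0 by simp
      then show "b i = 0" using u(1) bk i unfolding int_indep_def by (metis less_SucE)
    qed
    ultimately show ?thesis by metis
  qed
qed

text \<open>The image of \<open>G\<close> is spanned both by the columns of \<open>M\<close> and by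
  those of a Hermite form \<open>T\<close>, whose determinant is the index. Each matrix is an
  integral right multiple of the other, so the determinants divide each other. A singular
  \<open>M\<close> is covered, with both sides 0.\<close>

lemma quot_card_image_eq_det:
  fixes G :: "'v \<Rightarrow> 'v"
  assumes w: "int_indep w n" and G: "\<And>x y. G (x - y) = G x - G y"
    and M: "M \<in> carrier_mat n n" "\<And>j. j < n \<Longrightarrow> G (w j) = int_comb w n (\<lambda>i. M $$ (i, j))"
  shows "int (quot_card (int_span w n) (G ` int_span w n)) = \<bar>det M\<bar>"
proof -
  let ?N = "G ` int_span w n"
  have G_comb: "G (int_comb w n a) = int_comb w n (\<lambda>i. \<Sum>j<n. M $$ (i, j) * a j)" for a
  proof -
    have "G (int_comb w n a) = int_comb (\<lambda>j. int_comb w n (\<lambda>i. M $$ (i, j))) n a"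
      unfolding additive_int_comb[OF G] by (rule int_comb_cong) (simp_all add: M)
    then show ?thesis by (simp add: int_comb_matrix)
  qed
  have N: "add_subgroup ?N" by (rule add_subgroup_image[OF add_subgroup_int_span G])
  have "?N \<subseteq> int_span w n" using G_comb by (auto simp: int_span_def)
  from hermite_normal_form[OF w N this] obtain T where
    T: "\<forall>i j. j < i \<longrightarrow> T i j = 0" "\<forall>j. T j j \<ge> 0"
      "?N = int_span (\<lambda>j. int_comb w n (\<lambda>i. T i j)) n"
      "quot_card (int_span w n) ?N = nat (\<Prod>j<n. T j j)" by blast
  let ?u = "\<lambda>j. int_comb w n (\<lambda>i. T i j)"
  define Tm where "Tm = mat n n (\<lambda>(i, j). T i j)"
  have Tm: "Tm \<in> carrier_mat n n" by (simp add: Tm_def)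
  have detT: "det Tm = (\<Prod>j<n. T j j)"
  proof -
    have "upper_triangular Tm" using T(1) by (auto simp: Tm_def)
    then have "det Tm = prod_list (diag_mat Tm)" using Tm by (rule det_upper_triangular)
    also have "\<dots> = (\<Prod>j<n. T j j)"
      by (simp add: prod_list_diag_prod Tm_def atLeast0LessThan)
    finally show ?thesis .
  qed
  have "\<exists>a. ?u j = int_comb w n (\<lambda>i. \<Sum>l<n. M $$ (i, l) * a l)" if "j < n" for j
  proof -
    have "?u j \<in> ?N" unfolding T(3) by (rule int_span_base[OF that])
    then show ?thesis using G_comb by (auto simp: int_span_def)
  qed
  then have "\<forall>j. \<exists>a. j < n \<longrightarrow> ?u j = int_comb w n (\<lambda>i. \<Sum>l<n. M $$ (i, l) * a l)" by blast
  from choice[OF this] obtain X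
    where X: "\<forall>j. j < n \<longrightarrow> ?u j = int_comb w n (\<lambda>i. \<Sum>l<n. M $$ (i, l) * X j l)" ..
  define Xm where "Xm = mat n n (\<lambda>(l, j). X j l)"
  have Xm: "Xm \<in> carrier_mat n n" by (simp add: Xm_def)
  have "Tm = M * Xm"
  proof (rule eq_matI)
    fix i j assume "i < dim_row (M * Xm)" "j < dim_col (M * Xm)"
    then have ij: "i < n" "j < n" using M Xm by auto
    have "T i j = (\<Sum>l<n. M $$ (i, l) * X j l)" using int_indepD[OF w X[rule_format, OF ij(2)] ij(1)] .
    then show "Tm $$ (i, j) = (M * Xm) $$ (i, j)"
      using ij M by (simp add: Tm_def Xm_def scalar_prod_def atLeast0LessThan)
  qed (use M Tm Xm in auto)
  then have d1: "det M dvd det Tm" using det_mult[OF M(1) Xm] by simp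
  have "\<exists>a. G (w j) = int_comb ?u n a" if "j < n" for j
  proof -
    have "w j \<in> int_span w n" by (rule int_span_base[OF that])
    then have "G (w j) \<in> int_span ?u n" unfolding T(3)[symmetric] by simp
    then show ?thesis by (auto simp: int_span_def)
  qed
  then have "\<forall>j. \<exists>a. j < n \<longrightarrow> G (w j) = int_comb ?u n a" by blast
  from choice[OF this] obtain Y where Y: "\<forall>j. j < n \<longrightarrow> G (w j) = int_comb ?u n (Y j)" ..
  define Ym where "Ym = mat n n (\<lambda>(l, j). Y j l)"
  have Ym: "Ym \<in> carrier_mat n n" by (simp add: Ym_def)
  have "M = Tm * Ym"
  proof (rule eq_matI)
    fix i j assume "i < dim_row (Tm * Ym)" "j < dim_col (Tm * Ym)"
    then have ij: "i < n" "j < n" using Tm Ym by auto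
    have "int_comb w n (\<lambda>i. M $$ (i, j)) = int_comb w n (\<lambda>i. \<Sum>l<n. T i l * Y j l)"
      using M(2)[OF ij(2)] Y[rule_format, OF ij(2)] by (simp add: int_comb_matrix)
    from int_indepD[OF w this ij(1)]
    show "M $$ (i, j) = (Tm * Ym) $$ (i, j)"
      using ij by (simp add: Tm_def Ym_def scalar_prod_def atLeast0LessThan)
  qed (use M Tm Ym in auto)
  then have d2: "det Tm dvd det M" using det_mult[OF Tm Ym] by simp
  have "\<bar>det M\<bar> = \<bar>det Tm\<bar>" using d1 d2 by (rule zdvd_antisym_abs)
  then show ?thesis using T(4) T(2) by (simp add: detT prod_nonneg)
qed

lemma endo_matrix_exists:
  assumes "\<And>x. x \<in> int_span u k \<Longrightarrow> G x \<in> int_span u k"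
  obtains M where "M \<in> carrier_mat k k" "\<And>j. j < k \<Longrightarrow> G (u j) = int_comb u k (\<lambda>i. M $$ (i, j))"
proof -
  have "\<exists>a. G (u j) = int_comb u k a" if "j < k" for j
    using assms[OF int_span_base[OF that]] by (auto simp: int_span_def)
  then have "\<forall>j. \<exists>a. j < k \<longrightarrow> G (u j) = int_comb u k a" by blast
  from choice[OF this] obtain A where A: "\<forall>j. j < k \<longrightarrow> G (u j) = int_comb u k (A j)" ..
  have "G (u j) = int_comb u k (\<lambda>i. mat k k (\<lambda>(i, j). A j i) $$ (i, j))" if "j < k" for j
    unfolding A[rule_format, OF that] by (rule int_comb_cong) (auto simp: that)
  then show thesis using that[of "mat k k (\<lambda>(i, j). A j i)"] by simp
qed

lemma det_nonzero_iff_inj: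
  fixes G :: "'v \<Rightarrow> 'v"
  assumes w: "int_indep w n" and G: "\<And>x y. G (x - y) = G x - G y"
    and M: "M \<in> carrier_mat n n" "\<And>j. j < n \<Longrightarrow> G (w j) = int_comb w n (\<lambda>i. M $$ (i, j))"
  shows "det M \<noteq> 0 \<longleftrightarrow> (\<forall>x\<in>int_span w n. G x = 0 \<longrightarrow> x = 0)"
proof -
  have G_comb: "G (int_comb w n a) = int_comb w n (\<lambda>i. \<Sum>j<n. M $$ (i, j) * a j)" for a
  proof -
    have "G (int_comb w n a) = int_comb (\<lambda>j. int_comb w n (\<lambda>i. M $$ (i, j))) n a"
      unfolding additive_int_comb[OF G] by (rule int_comb_cong) (simp_all add: M)
    then show ?thesis by (simp add: int_comb_matrix)
  qed
  have mv: "(M *\<^sub>v v) $ i = (\<Sum>j<n. M $$ (i, j) * v $ j)" if "v \<in> carrier_vec n" "i < n" for v i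
    using that M(1) by (simp add: scalar_prod_def atLeast0LessThan)
  show ?thesis
  proof
    assume det: "det M \<noteq> 0"
    show "\<forall>x\<in>int_span w n. G x = 0 \<longrightarrow> x = 0"
    proof (intro ballI impI)
      fix x assume "x \<in> int_span w n" "G x = 0"
      then obtain a where a: "x = int_comb w n a" "G (int_comb w n a) = 0" by (auto simp: int_span_def)
      then have z: "(\<Sum>j<n. M $$ (i, j) * a j) = 0" if "i < n" for i
        using w that unfolding G_comb int_indep_def by blast
      let ?v = "vec n a"
      have "M *\<^sub>v ?v = 0\<^sub>v n"
        by (rule eq_vecI) (use M z mv[of ?v] in auto)
      then have "?v = 0\<^sub>v n" using det det_0_iff_vec_prod_zero[OF M(1)] by (metis vec_carrier)
      then have "a i = 0" if "i < n" for i using that by (metis index_vec index_zero_vec(1))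
      then show "x = 0" unfolding a using int_comb_cong[of n a "\<lambda>_. 0" w w] int_comb_zero by simp
    qed
  next
    assume inj: "\<forall>x\<in>int_span w n. G x = 0 \<longrightarrow> x = 0"
    show "det M \<noteq> 0"
    proof
      assume "det M = 0"
      then obtain v where v: "v \<in> carrier_vec n" "v \<noteq> 0\<^sub>v n" "M *\<^sub>v v = 0\<^sub>v n"
        using det_0_iff_vec_prod_zero[OF M(1)] by blast
      have "G (int_comb w n (\<lambda>i. v $ i)) = int_comb w n (\<lambda>_. 0)"
        unfolding G_comb by (rule int_comb_cong) (use v mv[OF v(1)] in auto)
      then have "int_comb w n (\<lambda>i. v $ i) = 0" using inj by (auto simp: int_span_def int_comb_zero)
      then have "\<forall>i<n. v $ i = 0" using w unfolding int_indep_def by blast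
      then have "v = 0\<^sub>v n" using v(1) by (intro eq_vecI) auto
      then show False using v by simp
    qed
  qed
qed

lemma quot_card_scale_int:
  assumes w: "int_indep w n"
  shows "int (quot_card (int_span w n) (scale (of_int m) ` int_span w n)) = \<bar>m\<bar> ^ n"
proof -
  have "int (quot_card (int_span w n) (scale (of_int m) ` int_span w n)) = \<bar>det (m \<cdot>\<^sub>m 1\<^sub>m n)\<bar>"
  proof (rule quot_card_image_eq_det[OF w])
    fix j assume "j < n"
    show "scale (of_int m) (w j) = int_comb w n (\<lambda>i. (m \<cdot>\<^sub>m 1\<^sub>m n) $$ (i, j))"
      unfolding int_comb_unit[OF \<open>j < n\<close>, symmetric]
      by (rule int_comb_cong) (use \<open>j < n\<close> in auto)
  qed (auto simp: scale_right_diff_distrib)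
  then show ?thesis by (simp add: power_abs)
qed

lemma shifted_matrix:
  assumes M: "M \<in> carrier_mat n n" "\<And>j. j < n \<Longrightarrow> F (w j) = int_comb w n (\<lambda>i. M $$ (i, j))"
    and "j < n"
  shows "scale (of_int t) (w j) - F (w j)
    = int_comb w n (\<lambda>i. mat n n (\<lambda>(i, j). (if i = j then t else 0) - M $$ (i, j)) $$ (i, j))"
proof -
  have "scale (of_int t) (w j) - F (w j)
      = int_comb w n (\<lambda>i. (if i = j then t else 0) - M $$ (i, j))"
    unfolding int_comb_diff int_comb_unit[OF \<open>j < n\<close>] using M(2)[OF \<open>j < n\<close>] by simp
  also have "\<dots> = int_comb w n (\<lambda>i. mat n n (\<lambda>(i, j). (if i = j then t else 0) - M $$ (i, j)) $$ (i, j))"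
    by (rule int_comb_cong) (use \<open>j < n\<close> in auto)
  finally show ?thesis .
qed

lemma poly_char_poly_int:
  assumes "M \<in> carrier_mat n n"
  shows "poly (char_poly M) t = det (mat n n (\<lambda>(i, j). (if i = j then t else 0) - M $$ (i, j)) :: int mat)"
  unfolding char_poly_def
  by (rule poly_det_cong[of _ n]) (use assms in \<open>auto simp: char_poly_matrix_def\<close>)

text \<open>Values of the characteristic polynomial at integers become, up to sign, indices in which
  no basis occurs. They can therefore be compared between a lattice and its subgroups without block
  matrices.\<close>

lemma quot_card_eq_char_poly:
  fixes F :: "'v \<Rightarrow> 'v"
  assumes w: "int_indep w n" and F: "\<And>x y. F (x - y) = F x - F y"
    and M: "M \<in> carrier_mat n n" "\<And>j. j < n \<Longrightarrow> F (w j) = int_comb w n (\<lambda>i. M $$ (i, j))"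
  shows "int (quot_card (int_span w n) ((\<lambda>x. scale (of_int t) x - F x) ` int_span w n))
      = \<bar>poly (char_poly M) t\<bar>"
    and "poly (char_poly M) t \<noteq> 0 \<longleftrightarrow>
      (\<forall>x\<in>int_span w n. scale (of_int t) x - F x = 0 \<longrightarrow> x = 0)"
  unfolding poly_char_poly_int[OF M(1)]
  by (rule quot_card_image_eq_det[OF w] det_nonzero_iff_inj[OF w];
      use shifted_matrix[OF M] in \<open>simp add: scale_right_diff_distrib F\<close>)+

end

section \<open>Isometries of lattices\<close>

lemma int_poly_eqI_infinite:
  fixes p q :: "int poly"
  assumes "infinite {t. poly p t = poly q t}"
  shows "p = q"
proof (rule ccontr)
  assume "p \<noteq> q"
  then have "finite {t. poly (p - q) t = 0}" by (intro poly_roots_finite) simp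
  then show False using assms by simp
qed

text \<open>The exponents are the multiplicities of the root 1, because the cofactors do not vanish
  there.\<close>

lemma linear_factor_power_cancel:
  fixes p q :: "int poly"
  assumes eq: "[:-1, 1:] ^ r * p = [:-1, 1:] ^ s * q" and nz: "poly p 1 \<noteq> 0" "poly q 1 \<noteq> 0"
  shows "r = s \<and> p = q"
proof -
  have *: "r = s \<and> p = q"
    if "r \<le> s" "[:-1, 1:] ^ r * p = [:-1, 1:] ^ s * q" "poly p 1 \<noteq> 0" for r s and p q :: "int poly"
  proof -
    have "[:-1, 1:] ^ r * p = [:-1, 1:] ^ r * ([:-1, 1:] ^ (s - r) * q)"
      using that by (simp add: mult.assoc[symmetric] power_add[symmetric])
    then have p: "p = [:-1, 1:] ^ (s - r) * q" by simp
    then have "poly p 1 = 0 ^ (s - r) * poly q 1" by simp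
    then have "s - r = 0" using that(3) by (metis mult_zero_left power_0_left)
    then show ?thesis using that(1) p by simp
  qed
  show ?thesis
    using *[of r s p q] *[of s r q p] assms by (metis nle_le)
qed

text \<open>The identification of V with \<Lambda> \<otimes> \<rat> enters through \<open>w\<close>
  and \<open>denominator\<close>: \<Lambda> is free, and every vector has a positive multiple in
  it.\<close>

locale lattice_isometry = rat_space scale
  for scale :: "rat \<Rightarrow> 'v::ab_group_add \<Rightarrow> 'v" +
  fixes w :: "nat \<Rightarrow> 'v" and n :: nat and \<Lambda> :: "'v set"
    and F D :: "'v \<Rightarrow> 'v" and B :: "'v \<Rightarrow> 'v \<Rightarrow> rat"
  assumes w: "int_indep w n" and \<Lambda>: "\<Lambda> = int_span w n"
    and denominator: "\<exists>m>0. scale (of_nat m) v \<in> \<Lambda>"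
    and F_diff: "F (x - y) = F x - F y"
    and F_scale: "F (scale q x) = scale q (F x)"
    and F_image: "F ` \<Lambda> = \<Lambda>"
    and F_D: "F v = v + D v"
    and torsion: "v \<in> \<Lambda> \<Longrightarrow> D (D v) = 0 \<Longrightarrow> D v = 0"
    and B: "biadditive B"
    and B_scale: "B (scale q x) y = q * B x y"
    and B_sym: "B x y = B y x"
    and isometry: "B (F x) (F y) = B x y"
    and dual_subset: "dual_lattice B \<Lambda> \<subseteq> \<Lambda>"
begin

abbreviation "\<Lambda>' \<equiv> dual_lattice B \<Lambda>"
abbreviation "K \<equiv> {x \<in> \<Lambda>. D x = 0}"
abbreviation "K' \<equiv> {x \<in> \<Lambda>'. D x = 0}"
abbreviation "L \<equiv> D ` \<Lambda>"
abbreviation "S \<equiv> \<Lambda> \<inter> range D"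
abbreviation "Y \<equiv> \<Lambda>' \<inter> range D"

lemma D_eq: "D v = F v - v"
  using F_D[of v] by simp

lemma D_diff: "D (x - y) = D x - D y"
  by (simp add: D_eq F_diff)

lemma D_scale: "D (scale q x) = scale q (D x)"
  by (simp add: D_eq F_scale scale_right_diff_distrib)

lemma D_zero: "D 0 = 0"
  using D_diff[of 0 0] by simp

lemma F_zero: "F 0 = 0"
  using F_diff[of 0 0] by simp

lemma D_uminus: "D (- x) = - D x"
  using D_diff[of 0 x] D_zero by simp

lemma D_add: "D (x + y) = D x + D y"
  using D_diff[of x "- y"] by (simp add: D_uminus)

lemma F_uminus: "F (- x) = - F x"
  using F_diff[of 0 x] F_zero by simp

lemma F_add: "F (x + y) = F x + F y"
  using F_diff[of x "- y"] by (simp add: F_uminus)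

lemma D_F: "D (F x) = F (D x)"
  by (simp add: D_eq F_diff)

lemma B_scale': "B x (scale q y) = q * B x y"
  using B_scale B_sym by metis

lemmas B_simps = biadditive_diff[OF B] biadditive_add[OF B] biadditive_zero[OF B]
  biadditive_uminus[OF B] B_scale B_scale'

lemma \<Lambda>_subgroup: "add_subgroup \<Lambda>"
  unfolding \<Lambda> by (rule add_subgroup_int_span)

lemma F_\<Lambda>: "x \<in> \<Lambda> \<Longrightarrow> F x \<in> \<Lambda>"
  using F_image by blast

lemma D_\<Lambda>: "x \<in> \<Lambda> \<Longrightarrow> D x \<in> \<Lambda>"
  unfolding D_eq by (intro add_subgroup_diff \<Lambda>_subgroup F_\<Lambda>)

lemma dual_subgroup: "add_subgroup \<Lambda>'"
  using add_subgroup_radical[OF B, of UNIV \<Lambda>]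
  by (simp add: radical_def dual_lattice_def add_subgroup_def)

lemma dual_iff: "x \<in> \<Lambda>' \<longleftrightarrow> (\<forall>l\<in>\<Lambda>. B x l \<in> \<int>)"
  by (simp add: dual_lattice_def)

lemma dual_\<Lambda>: "x \<in> \<Lambda>' \<Longrightarrow> x \<in> \<Lambda>"
  using dual_subset by blast

lemma F_dual_iff: "F x \<in> \<Lambda>' \<longleftrightarrow> x \<in> \<Lambda>'"
proof -
  have "(\<forall>l\<in>\<Lambda>. B (F x) l \<in> \<int>) \<longleftrightarrow> (\<forall>l\<in>F ` \<Lambda>. B (F x) l \<in> \<int>)" using F_image by simp
  then show ?thesis by (simp add: dual_iff isometry)
qed

lemma F_dual_image: "F ` \<Lambda>' = \<Lambda>'"
proof
  show "F ` \<Lambda>' \<subseteq> \<Lambda>'" using F_dual_iff by blast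
  show "\<Lambda>' \<subseteq> F ` \<Lambda>'"
  proof
    fix x assume x: "x \<in> \<Lambda>'"
    then obtain y where "y \<in> \<Lambda>" "x = F y" using dual_\<Lambda> F_image by blast
    then show "x \<in> F ` \<Lambda>'" using x F_dual_iff by blast
  qed
qed

lemma D_dual: "x \<in> \<Lambda>' \<Longrightarrow> D x \<in> \<Lambda>'"
  unfolding D_eq by (intro add_subgroup_diff dual_subgroup) (simp_all add: F_dual_iff)

lemma range_subgroup: "add_subgroup (range D)"
  by (rule add_subgroup_image) (auto simp: add_subgroup_def D_diff)

lemma kernel_subgroup:
  assumes "add_subgroup A"
  shows "add_subgroup {x \<in> A. D x = 0}"
  using add_subgroup_preimage[OF assms, of "{0}" D] by (simp add: D_diff add_subgroup_def)

lemma L_subgroup: "add_subgroup L"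
  by (rule add_subgroup_image[OF \<Lambda>_subgroup D_diff])

lemma S_subgroup: "add_subgroup S"
  by (rule add_subgroup_Int[OF \<Lambda>_subgroup range_subgroup])

lemma Y_subgroup: "add_subgroup Y"
  by (rule add_subgroup_Int[OF dual_subgroup range_subgroup])

lemma L_subset_S: "L \<subseteq> S"
  using D_\<Lambda> by auto

lemma scale_subgroup: "add_subgroup A \<Longrightarrow> add_subgroup (scale q ` A)"
  by (rule add_subgroup_image) (auto simp: scale_right_diff_distrib)

text \<open>Clearing denominators extends \<Lambda>[D] = \<Lambda>[D^2] from \<Lambda> to V.\<close>

lemma torsion_all:
  assumes "D (D v) = 0"
  shows "D v = 0"
proof -
  obtain m where m: "m > 0" "scale (of_nat m) v \<in> \<Lambda>" using denominator by blast
  have "D (scale (of_nat m) v) = 0" by (rule torsion[OF m(2)]) (simp add: D_scale assms)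
  then show ?thesis using m by (simp add: D_scale)
qed

lemma range_kernel_zero: "u \<in> range D \<Longrightarrow> D u = 0 \<Longrightarrow> u = 0"
  using torsion_all by auto

text \<open>Since \<open>k\<close> is fixed by \<open>F\<close>, invariance for \<open>a\<close> and
  \<open>k\<close> reads B(a + Da, k) = B(a, k). Hence DV and V[D] are orthogonal.\<close>

lemma range_kernel_orthogonal:
  assumes "u \<in> range D" "D k = 0"
  shows "B u k = 0"
proof -
  obtain a where "u = D a" using assms by auto
  then show ?thesis using isometry[of a k] assms by (simp add: F_D B_simps)
qed

text \<open>Invariance expanded in terms of \<open>D\<close>: it makes \<open>D\<close> skew-adjoint
  up to a term that is integral on the preimage of \<Lambda>' under \<open>D\<close>.\<close>

lemma B_D_D: "B a (D b) + B (D a) b = - B (D a) (D b)"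
  using isometry[of a b] by (simp add: F_D B_simps)

section \<open>Finiteness and comparison of indices\<close>

lemma quot_card_scale_pos:
  assumes A: "add_subgroup A" "A \<subseteq> \<Lambda>" and m: "m > 0"
  shows "0 < quot_card A (scale (of_nat m) ` A)"
proof -
  obtain u k where u: "int_indep u k" "A = int_span u k"
    using subgroup_of_int_span_is_free[OF w A(1)] A(2) unfolding \<Lambda> by blast
  have "int (quot_card A (scale (of_nat m) ` A)) = int m ^ k"
    using quot_card_scale_int[OF u(1), of "int m"] u(2) by simp
  then show ?thesis using m by (metis of_nat_0_less_iff zero_less_power)
qed

text \<open>A is free of finite rank. A common multiple N of the orders of its basis vectors modulo
  C carries A into C, and A modulo N A is finite.\<close>

lemma quot_card_pos:
  assumes A: "add_subgroup A" "A \<subseteq> \<Lambda>" and C: "add_subgroup C" "C \<subseteq> A"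
    and mult: "\<And>x. x \<in> A \<Longrightarrow> \<exists>m>0. scale (of_nat m) x \<in> C"
  shows "0 < quot_card A C"
proof -
  obtain u k where u: "int_indep u k" "A = int_span u k"
    using subgroup_of_int_span_is_free[OF w A(1)] A(2) unfolding \<Lambda> by blast
  have "\<forall>j. \<exists>m. j < k \<longrightarrow> m > 0 \<and> scale (of_nat m) (u j) \<in> C"
    using mult int_span_base[of _ k u] u(2) by blast
  from choice[OF this] obtain m where m: "\<forall>j. j < k \<longrightarrow> m j > 0 \<and> scale (of_nat (m j)) (u j) \<in> C" ..
  define N where "N = (\<Prod>j<k. m j)"
  have N: "N > 0" unfolding N_def using m by (simp add: prod_pos)
  have Nu: "scale (of_nat N) (u j) \<in> C" if "j < k" for j
  proof -
    have "N = (\<Prod>i\<in>{..<k} - {j}. m i) * m j"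
      unfolding N_def using that by (simp add: prod.remove[of _ j] mult.commute)
    then have "scale (of_nat N) (u j) = scale (of_nat (\<Prod>i\<in>{..<k} - {j}. m i)) (scale (of_nat (m j)) (u j))"
      by simp
    then show ?thesis using m that add_subgroup_scale_nat[OF C(1)] by metis
  qed
  have sub: "scale (of_nat N) ` A \<subseteq> C"
  proof -
    have "int_comb (\<lambda>j. scale (of_nat N) (u j)) i a \<in> C" if "i \<le> k" for i a
      using that by (induction i)
        (auto simp: int_comb_def add_subgroup_closed[OF C(1)] add_subgroup_scale_int[OF C(1)] Nu
          simp del: scale_scale)
    then have "scale (of_nat N) (int_comb u k a) \<in> C" for a
      by (simp add: additive_int_comb[where G = "scale (of_nat N)"] scale_right_diff_distrib)
    then show ?thesis unfolding u(2) by (auto simp: int_span_def)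
  qed
  have "quot_card A (scale (of_nat N) ` A) = quot_card A C * quot_card C (scale (of_nat N) ` A)"
    by (rule quot_card_mult) (use A C sub scale_subgroup in auto)
  then show ?thesis using quot_card_scale_pos[OF A N] by (metis mult_is_0 neq0_conv)
qed

lemma multiple_in_dual: "\<exists>m>0. scale (of_nat m) v \<in> \<Lambda>'"
proof -
  \<comment> \<open>The product of the denominators of the values of \<open>B v\<close> on the basis
    is a suitable multiplier.\<close>
  define d where "d i = snd (quotient_of (B v (w i)))" for i
  have d: "d i > 0" "of_int (d i) * B v (w i) \<in> \<int>" for i
  proof -
    obtain a b where ab: "quotient_of (B v (w i)) = (a, b)" by fastforce
    then have "B v (w i) = of_int a / of_int b" "b > 0"
      using quotient_of_div quotient_of_denom_pos by blast+
    then show "d i > 0" "of_int (d i) * B v (w i) \<in> \<int>" using ab by (simp_all add: d_def)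
  qed
  define N where "N = nat (\<Prod>i<n. d i)"
  have pos: "(\<Prod>i<n. d i) > 0" using d(1) by (simp add: prod_pos)
  have Nw: "of_nat N * B v (w i) \<in> \<int>" if "i < n" for i
  proof -
    have "(\<Prod>i<n. d i) = (\<Prod>j\<in>{..<n} - {i}. d j) * d i"
      using that by (simp add: prod.remove[of _ i] mult.commute)
    then have "rat_of_nat N * B v (w i) = of_int (\<Prod>j\<in>{..<n} - {i}. d j) * (of_int (d i) * B v (w i))"
      unfolding N_def using pos by simp
    then show ?thesis using d(2)[of i] by (metis Ints_mult Ints_of_int)
  qed
  have "B (scale (of_nat N) v) (int_comb w k a) \<in> \<int>" if "k \<le> n" for a k
    using that
  proof (induction k)
    case (Suc k)
    then have "B (scale (of_nat N) v) (int_comb w k a) + of_int (a k) * (of_nat N * B v (w k)) \<in> \<int>"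
      using Nw[of k] by (intro Ints_add Ints_mult[OF Ints_of_int]) auto
    then show ?case by (simp add: int_comb_Suc B_simps algebra_simps)
  qed (simp add: int_comb_def B_simps)
  then have "scale (of_nat N) v \<in> \<Lambda>'" by (auto simp: dual_iff \<Lambda> int_span_def dual_lattice_def)
  moreover have "N > 0" unfolding N_def using pos by simp
  ultimately show ?thesis by blast
qed

lemma quot_card_dual_pos: "0 < quot_card \<Lambda> \<Lambda>'"
  by (rule quot_card_pos) (use \<Lambda>_subgroup dual_subgroup dual_subset multiple_in_dual in auto)

lemma multiple_in_L:
  assumes "u \<in> range D"
  shows "\<exists>m>0. scale (of_nat m) u \<in> L"
proof -
  obtain v where v: "u = D v" using assms by auto
  obtain m where "m > 0" "scale (of_nat m) v \<in> \<Lambda>" using denominator by blast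
  then show ?thesis unfolding v using D_scale[of "of_nat m" v] by (metis imageI)
qed

lemma quot_card_S_L_pos: "0 < quot_card S L"
  by (rule quot_card_pos) (use S_subgroup L_subgroup L_subset_S multiple_in_L in auto)

lemma quot_card_S_Y_pos: "0 < quot_card S Y"
proof (rule quot_card_pos)
  fix x assume x: "x \<in> S"
  obtain m where "m > 0" "scale (of_nat m) x \<in> \<Lambda>'" using multiple_in_dual by blast
  moreover have "scale (of_nat m) x \<in> range D"
    using x add_subgroup_scale_nat[OF range_subgroup] by auto
  ultimately show "\<exists>m>0. scale (of_nat m) x \<in> Y" by blast
qed (use S_subgroup Y_subgroup dual_subset in auto)

text \<open>Both Y and L have finite index in S, through which the index is transported. For
  \<open>D\<close> this lets p(1) be read off from Y as well as from L.\<close>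

lemma endo_index_Y_L:
  assumes h: "\<And>x y. h (x - y) = h x - h y" "\<And>x. x \<in> S \<Longrightarrow> h x = 0 \<Longrightarrow> x = 0"
    and stable: "h ` S \<subseteq> S" "h ` Y \<subseteq> Y" "h ` L \<subseteq> L"
  shows "quot_card Y (h ` Y) = quot_card L (h ` L)"
proof -
  have "quot_card S (h ` S) = quot_card Y (h ` Y)"
    by (rule quot_card_endo_commensurable[OF S_subgroup Y_subgroup])
      (use h stable quot_card_S_Y_pos dual_subset in auto)
  moreover have "quot_card S (h ` S) = quot_card L (h ` L)"
    by (rule quot_card_endo_commensurable[OF S_subgroup L_subgroup])
      (use h stable quot_card_S_L_pos L_subset_S in auto)
  ultimately show ?thesis by simp
qed

lemma scale_stable: "add_subgroup A \<Longrightarrow> scale (of_nat m) ` A \<subseteq> A"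
  using add_subgroup_scale_nat by auto

lemma quot_card_Y_scale:
  assumes "m > 0"
  shows "quot_card Y (scale (of_nat m) ` Y) = quot_card L (scale (of_nat m) ` L)"
  by (rule endo_index_Y_L)
    (use assms scale_stable[OF S_subgroup] scale_stable[OF Y_subgroup] scale_stable[OF L_subgroup]
      in \<open>auto simp: scale_right_diff_distrib\<close>)

lemma quot_card_Y_D: "quot_card Y (D ` Y) = quot_card L (D ` L)"
  by (rule endo_index_Y_L)
    (use range_kernel_zero D_\<Lambda> D_dual in \<open>auto simp: D_diff\<close>)

text \<open>Let q be the characteristic polynomial of \<open>F\<close> on L and s the rank of K.
  Splitting \<Lambda> along \<open>D\<close> shows that at every integer t that is not a root, the
  value of \<open>char_poly M\<close> is q(t) (t - 1)^s up to sign. Squaring removes the sign, and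
  infinitely many values determine the polynomial. As \<open>D\<close> is injective on L, q(1) is
  nonzero, so comparing multiplicities of the root 1 gives \<open>r = s\<close> and
  \<open>p\<^sup>2 = q\<^sup>2\<close>.\<close>

lemma char_poly_at_one:
  fixes p :: "int poly"
  assumes M: "M \<in> carrier_mat n n" "\<And>j. j < n \<Longrightarrow> F (w j) = int_comb w n (\<lambda>i. M $$ (i, j))"
    and c: "char_poly M = [:-1, 1:] ^ r * p \<or> char_poly M = - ([:-1, 1:] ^ r * p)"
    and p: "poly p 1 > 0"
  shows "int (quot_card L (D ` L)) = poly p 1"
    and "m > 0 \<Longrightarrow> quot_card K (scale (of_nat m) ` K) = m ^ r"
proof -
  obtain u k where u: "int_indep u k" "L = int_span u k"
    using subgroup_of_int_span_is_free[OF w L_subgroup] L_subset_S \<Lambda> by blast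
  obtain u' s where u': "int_indep u' s" "K = int_span u' s"
    using subgroup_of_int_span_is_free[OF w kernel_subgroup[OF \<Lambda>_subgroup]] \<Lambda> by blast
  have FL: "F x \<in> L" if "x \<in> L" for x
    using that F_\<Lambda> D_F by (metis (no_types, lifting) image_iff)
  obtain M' where M': "M' \<in> carrier_mat k k"
    and M'_F: "\<And>j. j < k \<Longrightarrow> F (u j) = int_comb u k (\<lambda>i. M' $$ (i, j))"
    using endo_matrix_exists[of u k F] FL unfolding u(2) by blast
  define q where "q = char_poly M'"
  note cp = quot_card_eq_char_poly[OF w F_diff M, folded \<Lambda>]
  note cq = quot_card_eq_char_poly[OF u(1) F_diff M' M'_F, folded u(2) q_def]
  have "\<forall>x\<in>L. scale (of_int 1) x - F x = 0 \<longrightarrow> x = 0"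
    using range_kernel_zero by (auto simp: F_D)
  then have q1: "poly q 1 \<noteq> 0" using cq(2)[of 1] by blast
  have key: "\<bar>poly (char_poly M) t\<bar> = \<bar>poly q t\<bar> * \<bar>t - 1\<bar> ^ s" if t: "poly (char_poly M) t \<noteq> 0" for t
  proof -
    let ?G = "\<lambda>x. scale (of_int t) x - F x"
    have G_diff: "?G (x - y) = ?G x - ?G y" for x y by (simp add: F_diff scale_right_diff_distrib)
    have G\<Lambda>: "?G ` \<Lambda> \<subseteq> \<Lambda>" using F_\<Lambda> \<Lambda>_subgroup
      by (auto intro!: add_subgroup_diff add_subgroup_scale_int)
    have DG: "D (?G x) = ?G (D x)" for x by (simp add: D_diff D_scale D_F)
    have "D ` ?G ` \<Lambda> = ?G ` L" by (simp add: image_image DG)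
    \<comment> \<open>As t is not a root, \<open>?G\<close> is injective on \<Lambda>. Hence only
      elements of K are mapped into the kernel of \<open>D\<close>, and on K the map is
      multiplication by t - 1.\<close>
    moreover have "{x \<in> ?G ` \<Lambda>. D x = 0} = scale (of_int (t - 1)) ` K"
    proof (intro subset_antisym subsetI)
      fix x assume "x \<in> {x \<in> ?G ` \<Lambda>. D x = 0}"
      then obtain y where y: "y \<in> \<Lambda>" "x = ?G y" "D (?G y) = 0" by auto
      then have "?G (D y) = 0" by (simp add: DG)
      then have "D y = 0" using t cp(2) D_\<Lambda>[OF y(1)] by blast
      moreover from this have "x = scale (of_int (t - 1)) y"
        using y by (simp add: F_D scale_left_diff_distrib)
      ultimately show "x \<in> scale (of_int (t - 1)) ` K" using y by blast
    next
      fix x assume "x \<in> scale (of_int (t - 1)) ` K"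
      then obtain y where y: "y \<in> \<Lambda>" "D y = 0" "x = scale (of_int (t - 1)) y" by auto
      then have "x = ?G y" by (simp add: F_D scale_left_diff_distrib)
      then show "x \<in> {x \<in> ?G ` \<Lambda>. D x = 0}" using y by (auto simp: D_scale D_diff D_F F_zero)
    qed
    ultimately have "quot_card \<Lambda> (?G ` \<Lambda>)
        = quot_card L (?G ` L) * quot_card K (scale (of_int (t - 1)) ` K)"
      using quot_card_image_kernel[OF \<Lambda>_subgroup add_subgroup_image[OF \<Lambda>_subgroup G_diff] G\<Lambda> D_diff]
      by simp
    then have "int (quot_card \<Lambda> (?G ` \<Lambda>))
        = int (quot_card L (?G ` L)) * int (quot_card K (scale (of_int (t - 1)) ` K))"
      by simp
    then show ?thesis
      using cp(1)[of t] cq(1)[of t] quot_card_scale_int[OF u'(1), of "t - 1"] u'(2) by simp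
  qed
  have "char_poly M \<noteq> 0" using c p by auto
  then have "finite {t. poly (char_poly M) t = 0}" by (rule poly_roots_finite)
  then have "infinite {t. poly (char_poly M) t \<noteq> 0}"
    using infinite_UNIV_int finite_Collect_not by blast
  moreover have "{t. poly (char_poly M) t \<noteq> 0}
      \<subseteq> {t. poly ((char_poly M)\<^sup>2) t = poly (([:-1, 1:] ^ s * q)\<^sup>2) t}"
  proof
    fix t assume "t \<in> {t. poly (char_poly M) t \<noteq> 0}"
    then have "\<bar>poly (char_poly M) t\<bar>\<^sup>2 = (\<bar>poly q t\<bar> * \<bar>t - 1\<bar> ^ s)\<^sup>2" using key by simp
    then have "(poly (char_poly M) t)\<^sup>2 = (poly q t)\<^sup>2 * ((t - 1) ^ s)\<^sup>2"
      by (simp add: power_mult_distrib power_abs[symmetric])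
    then show "t \<in> {t. poly ((char_poly M)\<^sup>2) t = poly (([:-1, 1:] ^ s * q)\<^sup>2) t}"
      by (simp add: poly_power power_mult_distrib mult.commute)
  qed
  ultimately have "(char_poly M)\<^sup>2 = ([:-1, 1:] ^ s * q)\<^sup>2"
    using int_poly_eqI_infinite infinite_super by blast
  moreover have "(char_poly M)\<^sup>2 = ([:-1, 1:] ^ r * p)\<^sup>2" using c by auto
  ultimately have "[:-1, 1:] ^ (r * 2) * p\<^sup>2 = [:-1, 1:] ^ (s * 2) * q\<^sup>2"
    by (simp add: power_mult_distrib power_mult)
  then have "r * 2 = s * 2 \<and> p\<^sup>2 = q\<^sup>2"
    by (rule linear_factor_power_cancel) (use p q1 in \<open>auto simp: poly_power\<close>)
  then have rs: "r = s" and pq: "p\<^sup>2 = q\<^sup>2" by auto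
  have "(poly p 1)\<^sup>2 = (poly q 1)\<^sup>2" using pq by (metis poly_power)
  then have "poly p 1 = \<bar>poly q 1\<bar>" using p by (metis abs_of_pos power2_eq_iff abs_minus_cancel)
  \<comment> \<open>At t = 1 the map is - D, and the sign is absorbed because L = - L.\<close>
  moreover have "(\<lambda>x. scale (of_int 1) x - F x) ` L = D ` L"
  proof -
    have "(\<lambda>x. scale (of_int 1) x - F x) ` L = (\<lambda>x. D (- x)) ` L" by (simp add: F_D D_uminus)
    also have "\<dots> = D ` uminus ` L" by (simp add: image_image)
    also have "uminus ` L = L"
      using add_subgroup_uminus[OF L_subgroup] by (metis (no_types, lifting) image_subset_iff minus_minus subset_antisym subsetI image_eqI)
    finally show ?thesis .
  qed
  ultimately show "int (quot_card L (D ` L)) = poly p 1" using cq(1)[of 1] by simp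
  show "quot_card K (scale (of_nat m) ` K) = m ^ r" if "m > 0"
  proof -
    have "int (quot_card K (scale (of_nat m) ` K)) = int (m ^ r)"
      using quot_card_scale_int[OF u'(1), of "int m"] u'(2) rs by simp
    then show ?thesis by (simp only: of_nat_eq_iff)
  qed
qed


section \<open>The splitting of V into DV and V[D], and dual lattices\<close>

lemma quot_card_L_D_pos: "0 < quot_card L (D ` L)"
proof -
  obtain u k where u: "int_indep u k" "L = int_span u k"
    using subgroup_of_int_span_is_free[OF w L_subgroup] L_subset_S \<Lambda> by blast
  have "D x \<in> L" if "x \<in> L" for x using that D_\<Lambda> by blast
  then obtain M where M: "M \<in> carrier_mat k k"
    "\<And>j. j < k \<Longrightarrow> D (u j) = int_comb u k (\<lambda>i. M $$ (i, j))"
    using endo_matrix_exists[of u k D] unfolding u(2) by blast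
  have "\<forall>x\<in>L. D x = 0 \<longrightarrow> x = 0" using range_kernel_zero by blast
  then have "det M \<noteq> 0" using det_nonzero_iff_inj[OF u(1) D_diff M, folded u(2)] by blast
  then show ?thesis using quot_card_image_eq_det[OF u(1) D_diff M, folded u(2)] by simp
qed

lemma range_plus_kernel: "\<exists>a. D (v - D a) = 0"
proof -
  obtain m where m: "m > 0" "scale (of_nat m) v \<in> \<Lambda>" using denominator by blast
  have DL: "add_subgroup (D ` L)" by (rule add_subgroup_image[OF L_subgroup D_diff])
  obtain k :: nat where k: "k > 0" "scale (of_nat k) (D (scale (of_nat m) v)) \<in> D ` L"
    using multiple_in_finite_index[OF L_subgroup DL quot_card_L_D_pos imageI[OF m(2)]] by blast
  then obtain l where l: "D (D l) = scale (of_nat k * of_nat m) (D v)" by (auto simp: D_scale)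
  have "D v = D (D (scale (1 / (of_nat k * of_nat m)) l))"
    using k(1) m(1) by (simp add: D_scale l)
  then show ?thesis by (metis D_diff right_minus_eq)
qed

text \<open>Projection to DV along V[D]. The choice of \<open>a\<close> is immaterial, because
  \<open>D\<close> is injective on DV; see \<open>proj_unique\<close>.\<close>

definition proj :: "'v \<Rightarrow> 'v" where
  "proj v = D (SOME a. D (v - D a) = 0)"

lemma proj_range: "proj v \<in> range D"
  by (simp add: proj_def)

lemma D_proj: "D (v - proj v) = 0"
  unfolding proj_def using someI_ex[OF range_plus_kernel] .

lemma proj_unique:
  assumes "u \<in> range D" "D (v - u) = 0"
  shows "proj v = u"
proof -
  have "D (proj v - u) = 0" using assms(2) D_proj[of v] by (simp add: D_diff)
  then have "proj v - u = 0"
    using range_kernel_zero add_subgroup_diff[OF range_subgroup proj_range assms(1)] by blast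
  then show ?thesis by simp
qed

lemma proj_diff: "proj (x - y) = proj x - proj y"
  by (rule proj_unique)
    (use D_proj[of x] D_proj[of y] in \<open>auto simp: D_diff intro: add_subgroup_diff[OF range_subgroup] proj_range\<close>)

lemma B_proj: "B (proj x) y = B x (proj y)"
proof -
  have "B (proj x) (y - proj y) = 0" "B (proj y) (x - proj x) = 0"
    by (rule range_kernel_orthogonal[OF proj_range D_proj])+
  then show ?thesis using B_sym by (simp add: B_simps)
qed

text \<open>This turns the denominator of the group \<T>_D into an integrality condition on
  \<open>proj\<close>, so that it can be recognised as a radical.\<close>

lemma proj_mem_iff:
  assumes A: "add_subgroup A" and x: "x \<in> A"
  shows "proj x \<in> A \<longleftrightarrow> x \<in> (A \<inter> range D) + {x \<in> A. D x = 0}"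
proof
  assume "proj x \<in> A"
  then have "proj x \<in> A \<inter> range D" "x - proj x \<in> {x \<in> A. D x = 0}"
    using proj_range D_proj x A by (auto intro: add_subgroup_diff)
  then have "proj x + (x - proj x) \<in> (A \<inter> range D) + {x \<in> A. D x = 0}" by (rule set_plus_intro)
  then show "x \<in> (A \<inter> range D) + {x \<in> A. D x = 0}" by simp
next
  assume "x \<in> (A \<inter> range D) + {x \<in> A. D x = 0}"
  then obtain s k where "s \<in> A" "s \<in> range D" "D k = 0" "x = s + k" by (auto elim: set_plus_elim)
  then have "proj x = s" by (intro proj_unique) auto
  then show "proj x \<in> A" using \<open>s \<in> A\<close> by simp
qed

text \<open>Comparing indices shows that a subgroup of the left radical of \<open>B / m\<close> is the whole
  radical; this replaces the usual construction of a dual basis.\<close>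
lemma multiple_in_dual_radical:
  assumes A: "add_subgroup A" and m: "m > 0"
    and saturated: "\<And>y. y \<in> \<Lambda>' \<Longrightarrow> scale (of_nat m) y \<in> A \<Longrightarrow> y \<in> A"
    and R: "add_subgroup R" "R \<subseteq> \<Lambda>" "\<And>x y. x \<in> R \<Longrightarrow> y \<in> A \<Longrightarrow> B x y / of_nat m \<in> \<int>"
    and index: "quot_card \<Lambda> R = quot_card A (scale (of_nat m) ` A)" "0 < quot_card \<Lambda> R"
    and sub: "A \<subseteq> \<Lambda>'"
    and z: "scale (of_nat m) z \<in> \<Lambda>" "\<And>y. y \<in> A \<Longrightarrow> B z y \<in> \<int>"
  shows "scale (of_nat m) z \<in> R"
proof -
  let ?\<beta> = "\<lambda>x y. B x y / of_nat m"
  have \<beta>: "biadditive ?\<beta>" by (simp add: biadditive_def B_simps diff_divide_distrib)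
  have rad_A: "radical ?\<beta> A \<Lambda> = scale (of_nat m) ` A"
  proof (intro subset_antisym subsetI)
    fix y assume "y \<in> radical ?\<beta> A \<Lambda>"
    then have y: "y \<in> A" "\<forall>x\<in>\<Lambda>. B y x / of_nat m \<in> \<int>" by (auto simp: radical_def)
    \<comment> \<open>Integrality of \<open>B y / m\<close> on \<Lambda> puts y/m into \<Lambda>';
      saturation then brings it back into A.\<close>
    define y' where "y' = scale (1 / of_nat m) y"
    have "scale (of_nat m) y' = y" using m by (simp add: y'_def)
    moreover have "y' \<in> \<Lambda>'" unfolding dual_iff y'_def using y(2) by (simp add: B_simps)
    ultimately show "y \<in> scale (of_nat m) ` A" using saturated y(1) by (metis imageI)
  next
    fix y assume "y \<in> scale (of_nat m) ` A"
    then obtain y' where y': "y' \<in> A" "y = scale (of_nat m) y'" by auto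
    then have "B y' x \<in> \<int>" if "x \<in> \<Lambda>" for x using sub that by (auto simp: dual_iff)
    then show "y \<in> radical ?\<beta> A \<Lambda>"
      using y' m add_subgroup_scale_nat[OF A] by (auto simp: radical_def B_simps)
  qed
  let ?R = "radical ?\<beta> \<Lambda> A"
  have swap: "(\<lambda>x y. ?\<beta> y x) = ?\<beta>" using B_sym by (intro ext) simp
  have "quot_card \<Lambda> ?R = quot_card A (scale (of_nat m) ` A)"
    using quot_card_radical[OF \<beta> A \<Lambda>_subgroup] index unfolding swap rad_A by simp
  moreover have R': "add_subgroup ?R" "?R \<subseteq> \<Lambda>" "R \<subseteq> ?R"
    using add_subgroup_radical[OF \<beta> \<Lambda>_subgroup] R by (auto simp: radical_def)
  then have "quot_card \<Lambda> R = quot_card \<Lambda> ?R * quot_card ?R R"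
    by (intro quot_card_mult \<Lambda>_subgroup R)
  ultimately have "quot_card ?R R = 1" using index by simp
  then have "?R = R" using quot_card_one_imp_eq[OF R'(1) R(1) R'(3)] by simp
  moreover have "scale (of_nat m) z \<in> ?R" using z m by (auto simp: radical_def B_simps)
  ultimately show ?thesis by simp
qed

text \<open>Index comparison with A = \<Lambda>' and R = m \<Lambda>, where m clears the
  denominators of \<open>z\<close>.\<close>

lemma bidual:
  assumes z: "\<And>y. y \<in> \<Lambda>' \<Longrightarrow> B z y \<in> \<int>"
  shows "z \<in> \<Lambda>"
proof -
  obtain m where m: "m > 0" "scale (of_nat m) z \<in> \<Lambda>" using denominator by blast
  have "scale (of_nat m) z \<in> scale (of_nat m) ` \<Lambda>"
  proof (rule multiple_in_dual_radical[OF dual_subgroup m(1)])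
    show "quot_card \<Lambda> (scale (of_nat m) ` \<Lambda>) = quot_card \<Lambda>' (scale (of_nat m) ` \<Lambda>')"
      by (rule quot_card_endo_commensurable[OF \<Lambda>_subgroup dual_subgroup dual_subset quot_card_dual_pos])
        (use m scale_stable[OF \<Lambda>_subgroup] scale_stable[OF dual_subgroup]
          in \<open>auto simp: scale_right_diff_distrib\<close>)
    show "0 < quot_card \<Lambda> (scale (of_nat m) ` \<Lambda>)"
      by (rule quot_card_scale_pos[OF \<Lambda>_subgroup _ m(1)]) simp
    show "B x y / of_nat m \<in> \<int>" if "x \<in> scale (of_nat m) ` \<Lambda>" "y \<in> \<Lambda>'" for x y
      using that m B_sym by (auto simp: B_simps dual_iff)
  qed (use z m \<Lambda>_subgroup scale_stable[OF \<Lambda>_subgroup] in \<open>auto intro: scale_subgroup\<close>)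
  then show ?thesis using m by auto
qed

text \<open>The dual of Y is \<Lambda> + V[D]; membership in that sum is expressed by applying
  \<open>D\<close>. The candidate radical \<open>R\<close> is the part of \<Lambda> lying in m
  \<Lambda> + V[D].\<close>

lemma bidual_Y:
  assumes z: "\<And>y. y \<in> Y \<Longrightarrow> B z y \<in> \<int>"
  shows "D z \<in> L"
proof -
  obtain m where m: "m > 0" "scale (of_nat m) z \<in> \<Lambda>" using denominator by blast
  define R where "R = {x \<in> \<Lambda>. D x \<in> scale (of_nat m) ` L}"
  have mL: "add_subgroup (scale (of_nat m) ` L)" by (rule scale_subgroup[OF L_subgroup])
  have R: "add_subgroup R"
    unfolding R_def by (rule add_subgroup_preimage[OF \<Lambda>_subgroup mL D_diff])
  have index: "quot_card \<Lambda> R = quot_card L (scale (of_nat m) ` L)"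
    by (rule quot_card_iso[where h = D])
      (use \<Lambda>_subgroup R mL add_subgroup_zero[OF mL] in \<open>auto simp: R_def D_diff intro!: bexI\<close>)
  have "scale (of_nat m) z \<in> R"
  proof (rule multiple_in_dual_radical[OF Y_subgroup m(1)])
    show "quot_card \<Lambda> R = quot_card Y (scale (of_nat m) ` Y)"
      using index quot_card_Y_scale[OF m(1)] by simp
    show "0 < quot_card \<Lambda> R"
      unfolding index by (rule quot_card_scale_pos[OF L_subgroup _ m(1)]) (use D_\<Lambda> in auto)
    show "y \<in> Y" if y: "y \<in> \<Lambda>'" "scale (of_nat m) y \<in> Y" for y
    proof -
      obtain a where a: "D a = scale (of_nat m) y" using y(2) by auto
      have "y = D (scale (1 / of_nat m) a)" using m by (simp add: D_scale a)
      then show ?thesis using y by blast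
    qed
    show "B x y / of_nat m \<in> \<int>" if "x \<in> R" "y \<in> Y" for x y
    proof -
      obtain l where l: "l \<in> \<Lambda>" "D x = scale (of_nat m) (D l)" using \<open>x \<in> R\<close> by (auto simp: R_def)
      then have "D (x - scale (of_nat m) l) = 0" by (simp add: D_diff D_scale)
      then have "B y (x - scale (of_nat m) l) = 0"
        using range_kernel_orthogonal that by blast
      then have "B y x = of_nat m * B y l" by (simp add: B_simps)
      then show ?thesis using that l m by (simp add: B_sym[of x] dual_iff)
    qed
  qed (use z m R in \<open>auto simp: R_def\<close>)
  then show ?thesis using m by (auto simp: R_def D_scale)
qed

text \<open>The pairing (\<open>proj x\<close>, y) between \<Lambda> and \<Lambda>' has the two
  denominators as its radicals: on the left by \<open>bidual\<close>, on the right because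
  \<open>proj\<close> is self-adjoint. So the groups \<T>_D of \<Lambda> and \<Lambda>' are
  dual.\<close>

lemma quot_card_T_dual: "quot_card \<Lambda> (S + K) = quot_card \<Lambda>' (Y + K')"
  and quot_card_T_pos: "0 < quot_card \<Lambda> (S + K)"
proof -
  let ?\<beta> = "\<lambda>x y. B (proj x) y"
  have \<beta>: "biadditive ?\<beta>" by (simp add: biadditive_def B_simps proj_diff)
  have left: "radical ?\<beta> \<Lambda> \<Lambda>' = S + K"
  proof (intro subset_antisym subsetI)
    fix x assume "x \<in> radical ?\<beta> \<Lambda> \<Lambda>'"
    then have "x \<in> \<Lambda>" "proj x \<in> \<Lambda>" using bidual by (auto simp: radical_def)
    then show "x \<in> S + K" using proj_mem_iff[OF \<Lambda>_subgroup] by blast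
  next
    fix x assume x: "x \<in> S + K"
    then have "x \<in> \<Lambda>" by (auto elim!: set_plus_elim intro: add_subgroup_add[OF \<Lambda>_subgroup])
    moreover from this have "proj x \<in> \<Lambda>" using x proj_mem_iff[OF \<Lambda>_subgroup] by blast
    ultimately show "x \<in> radical ?\<beta> \<Lambda> \<Lambda>'" using B_sym by (auto simp: radical_def dual_iff)
  qed
  have right: "radical (\<lambda>x y. ?\<beta> y x) \<Lambda>' \<Lambda> = Y + K'"
  proof (intro subset_antisym subsetI)
    fix y assume "y \<in> radical (\<lambda>x y. ?\<beta> y x) \<Lambda>' \<Lambda>"
    then have "y \<in> \<Lambda>'" "proj y \<in> \<Lambda>'" using B_sym B_proj by (auto simp: radical_def dual_iff)
    then show "y \<in> Y + K'" using proj_mem_iff[OF dual_subgroup] by blast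
  next
    fix y assume y: "y \<in> Y + K'"
    then have "y \<in> \<Lambda>'" by (auto elim!: set_plus_elim intro: add_subgroup_add[OF dual_subgroup])
    moreover from this have "proj y \<in> \<Lambda>'" using y proj_mem_iff[OF dual_subgroup] by blast
    ultimately show "y \<in> radical (\<lambda>x y. ?\<beta> y x) \<Lambda>' \<Lambda>"
      using B_sym B_proj by (auto simp: radical_def dual_iff)
  qed
  show pos: "0 < quot_card \<Lambda> (S + K)"
  proof (rule quot_card_pos)
    fix x assume x: "x \<in> \<Lambda>"
    obtain m where m: "m > 0" "scale (of_nat m) (proj x) \<in> \<Lambda>" using denominator by blast
    have "proj (scale (of_nat m) x) = scale (of_nat m) (proj x)"
      using D_proj[of x] proj_range[of x] add_subgroup_scale_nat[OF range_subgroup]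
      by (intro proj_unique) (auto simp: D_scale simp flip: scale_right_diff_distrib)
    then have "scale (of_nat m) x \<in> S + K"
      using proj_mem_iff[OF \<Lambda>_subgroup add_subgroup_scale_nat[OF \<Lambda>_subgroup x]] m by metis
    then show "\<exists>m>0. scale (of_nat m) x \<in> S + K" using m by blast
  qed (use \<Lambda>_subgroup S_subgroup kernel_subgroup[OF \<Lambda>_subgroup] in
      \<open>auto simp: add_subgroup_plus elim!: set_plus_elim intro: add_subgroup_add\<close>)
  show "quot_card \<Lambda> (S + K) = quot_card \<Lambda>' (Y + K')"
    using quot_card_radical[OF \<beta> \<Lambda>_subgroup dual_subgroup] pos unfolding left right by simp
qed

section \<open>The group X = Y/(Y \<inter> L) and its multiples\<close>

definition Z :: "'v set" where
  "Z = {a. D a \<in> \<Lambda>'}"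

text \<open>Kernel of the map from Z onto m X given by \<open>a\<close> \<mapsto> m D a, so the
  quotient of Z by \<open>W m\<close> is m X. Working in Z avoids choosing preimages under
  \<open>D\<close>.\<close>

definition W :: "nat \<Rightarrow> 'v set" where
  "W m = {a \<in> Z. scale (of_nat m) (D a) \<in> L}"

lemma Z_subgroup: "add_subgroup Z"
  using add_subgroup_preimage[of UNIV \<Lambda>' D] dual_subgroup
  by (simp add: Z_def add_subgroup_def D_diff)

lemma W_subgroup: "add_subgroup (W m)"
  unfolding W_def
  by (rule add_subgroup_preimage[OF Z_subgroup L_subgroup]) (simp add: D_diff scale_right_diff_distrib)

lemma W_subset_Z: "W m \<subseteq> Z"
  by (auto simp: W_def)

lemma quot_card_Z_W: "quot_card Z (W m) = quot_card (scale (of_nat m) ` Y) (scale (of_nat m) ` Y \<inter> L)"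
proof (rule quot_card_iso[where h = "\<lambda>a. scale (of_nat m) (D a)"])
  fix y assume "y \<in> scale (of_nat m) ` Y"
  then obtain a where "D a \<in> \<Lambda>'" "y = scale (of_nat m) (D a)" by auto
  then show "\<exists>a\<in>Z. y - scale (of_nat m) (D a) \<in> scale (of_nat m) ` Y \<inter> L"
    using add_subgroup_zero[OF scale_subgroup[OF Y_subgroup]] add_subgroup_zero[OF L_subgroup]
    by (intro bexI[of _ a]) (auto simp: Z_def)
qed (use Z_subgroup W_subgroup in
    \<open>auto simp: W_def Z_def D_diff scale_right_diff_distrib
      intro!: add_subgroup_Int scale_subgroup Y_subgroup L_subgroup\<close>)

lemma quot_card_Z_W_pos: "0 < quot_card Z (W m)"
  unfolding quot_card_Z_W
proof (rule quot_card_pos)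
  fix x assume x: "x \<in> scale (of_nat m) ` Y"
  then have "x \<in> range D" using scale_stable[OF Y_subgroup] by blast
  then obtain k where "k > 0" "scale (of_nat k) x \<in> L" using multiple_in_L by blast
  then show "\<exists>k>0. scale (of_nat k) x \<in> scale (of_nat m) ` Y \<inter> L"
    using add_subgroup_scale_nat[OF scale_subgroup[OF Y_subgroup] x] by blast
next
  show "scale (of_nat m) ` Y \<subseteq> \<Lambda>" using scale_stable[OF Y_subgroup, of m] dual_subset by blast
qed (intro add_subgroup_Int scale_subgroup Y_subgroup L_subgroup Int_lower1)+

text \<open>The form m B(a, D b) on Z has radical \<open>W m\<close> by \<open>bidual_Y\<close>.
  Since 2 B(a, D a) = - B(D a, D a) is integral on Z, the form is alternating modulo \<int> for even
  m.\<close>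

lemma quot_card_Z_W_even:
  assumes "even m"
  shows "\<exists>s>0. quot_card Z (W m) = s\<^sup>2"
proof -
  let ?\<beta> = "\<lambda>a b. of_nat m * B a (D b)"
  have \<beta>: "biadditive ?\<beta>" by (simp add: biadditive_def B_simps D_diff algebra_simps)
  have "radical ?\<beta> Z Z = W m"
  proof (intro subset_antisym subsetI)
    fix a assume "a \<in> radical ?\<beta> Z Z"
    then have a: "a \<in> Z" "\<forall>b\<in>Z. of_nat m * B a (D b) \<in> \<int>" by (auto simp: radical_def)
    have "D (scale (of_nat m) a) \<in> L"
      by (rule bidual_Y) (use a(2) in \<open>auto simp: Z_def B_simps\<close>)
    then show "a \<in> W m" using a by (simp add: W_def D_scale)
  next
    fix a assume a: "a \<in> W m"
    then obtain l where l: "l \<in> \<Lambda>" "scale (of_nat m) (D a) = D l" by (auto simp: W_def)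
    have "of_nat m * B a (D b) \<in> \<int>" if "b \<in> Z" for b
    proof -
      have "D (scale (of_nat m) a - l) = 0" using l by (simp add: D_diff D_scale)
      then have "B (D b) (scale (of_nat m) a - l) = 0" by (intro range_kernel_orthogonal) auto
      then have "of_nat m * B (D b) a = B (D b) l" by (simp add: B_simps)
      then show ?thesis using that l by (simp add: B_sym[of a] Z_def dual_iff)
    qed
    then show "a \<in> radical ?\<beta> Z Z" using a by (auto simp: radical_def W_def)
  qed
  moreover have "of_nat m * B a (D a) \<in> \<int>" if "a \<in> Z" for a
  proof -
    obtain k where k: "m = 2 * k" using assms by blast
    have "B (D a) (D a) \<in> \<int>" using that dual_\<Lambda> by (auto simp: Z_def dual_iff)
    moreover have "of_nat m * B a (D a) = - (of_nat k * B (D a) (D a))"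
      using B_D_D[of a a] B_sym[of a "D a"] unfolding k by (simp add: algebra_simps)
    ultimately show ?thesis by (metis Ints_minus Ints_mult Ints_of_nat)
  qed
  ultimately show ?thesis
    using quot_card_alternating_is_square[OF \<beta> Z_subgroup] quot_card_Z_W_pos[of m] by simp
qed

lemma W_mono: "W m \<subseteq> W (m * k)"
proof
  fix a assume "a \<in> W m"
  then have "a \<in> Z" "scale (of_nat k) (scale (of_nat m) (D a)) \<in> L"
    using add_subgroup_scale_nat[OF L_subgroup] unfolding W_def by blast+
  then show "a \<in> W (m * k)" by (simp add: W_def mult.commute)
qed

text \<open>With X identified with Z modulo \<open>W 1\<close>, the quotients compared are X[2] and
  X[2m]/X[m], which are isomorphic for odd m. The indices of \<open>W 2\<close> and of
  \<open>W (2 * m)\<close> in Z are squares by the even case.\<close>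

lemma quot_card_Z_W_odd:
  assumes "odd m"
  shows "\<exists>s>0. \<exists>t>0. quot_card Z (W m) * s\<^sup>2 = quot_card Z (W 1) * t\<^sup>2"
proof -
  obtain k where k: "m = 2 * k + 1" using assms by (elim oddE)
  have "quot_card (W 2) (W 1) = quot_card (W (2 * m)) (W m)"
  proof (rule quot_card_iso[where h = "\<lambda>x. x"])
    fix y assume y: "y \<in> W (2 * m)"
    have "scale (of_nat m) y \<in> W 2"
      using y add_subgroup_scale_nat[OF Z_subgroup, of y m] by (simp add: W_def D_scale mult.commute)
    \<comment> \<open>From m = 2k + 1: the witness \<open>m y\<close> lies in \<open>W 2\<close> and
      differs from \<open>y\<close> by a multiple of \<open>2 y\<close>, which lies in
      \<open>W m\<close>.\<close>
    moreover have "y - scale (of_nat m) y = - scale (of_nat k) (scale 2 y)"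
      unfolding k by (simp add: scale_left_distrib algebra_simps)
    moreover have "scale 2 y \<in> W m"
      using y add_subgroup_scale_nat[OF Z_subgroup, of y 2] by (simp add: W_def D_scale mult.commute)
    ultimately show "\<exists>x\<in>W 2. y - x \<in> W m"
      using add_subgroup_uminus[OF W_subgroup add_subgroup_scale_nat[OF W_subgroup]] by metis
  next
    fix x assume x: "x \<in> W 2"
    then show "x \<in> W (2 * m)" using W_mono by blast
    show "x \<in> W 1 \<longleftrightarrow> x \<in> W m"
    proof
      show "x \<in> W m" if "x \<in> W 1" using W_mono[of 1 m] that by auto
      assume "x \<in> W m"
      then have "scale (of_nat m) (D x) \<in> L" "scale (of_nat 2) (D x) \<in> L"
        using x unfolding W_def by blast+
      then have "scale (of_nat m) (D x) - scale (of_nat k) (scale (of_nat 2) (D x)) \<in> L"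
        using add_subgroup_diff[OF L_subgroup] add_subgroup_scale_nat[OF L_subgroup] by blast
      moreover have "scale (of_nat m) (D x) = scale (of_nat k) (scale (of_nat 2) (D x)) + D x"
        unfolding k by (simp add: scale_left_distrib mult.commute)
      ultimately have "D x \<in> L" by simp
      then show "x \<in> W 1" using x by (simp add: W_def)
    qed
  qed (use W_subgroup in auto)
  moreover have "quot_card Z (W 1) = quot_card Z (W 2) * quot_card (W 2) (W 1)"
    by (rule quot_card_mult[OF Z_subgroup W_subgroup W_subgroup _ W_subset_Z])
      (use W_mono[of 1 2] in simp)
  moreover have "quot_card Z (W m) = quot_card Z (W (2 * m)) * quot_card (W (2 * m)) (W m)"
    by (rule quot_card_mult[OF Z_subgroup W_subgroup W_subgroup _ W_subset_Z])
      (use W_mono[of m 2] in \<open>simp add: mult.commute\<close>)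
  moreover obtain s t where "s > 0" "quot_card Z (W 2) = s\<^sup>2" "t > 0" "quot_card Z (W (2 * m)) = t\<^sup>2"
    using quot_card_Z_W_even[of 2] quot_card_Z_W_even[of "2 * m"] by auto
  ultimately show ?thesis by (intro exI[of _ s] exI[of _ t] conjI) simp_all
qed

text \<open>Second isomorphism theorem: Z meets \<Lambda> + V[D] exactly in
  \<open>W 1\<close>.\<close>

lemma quot_card_B_group:
  "quot_card (\<Lambda> + D -` \<Lambda>') (\<Lambda> + torsion_in UNIV D) = quot_card Z (W 1)"
proof (rule quot_card_iso[where h = "\<lambda>x. x", symmetric])
  have T: "torsion_in UNIV D = {x \<in> UNIV. D x = 0}" by (simp add: torsion_in_def)
  have "add_subgroup (torsion_in UNIV D)"
    unfolding T by (rule kernel_subgroup) (simp add: add_subgroup_def)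
  then show LT: "add_subgroup (\<Lambda> + torsion_in UNIV D)" by (rule add_subgroup_plus[OF \<Lambda>_subgroup])
  fix y assume "y \<in> \<Lambda> + D -` \<Lambda>'"
  then obtain l a where "l \<in> \<Lambda>" "a \<in> Z" "y = l + a" by (auto simp: Z_def elim: set_plus_elim)
  moreover have "l + 0 \<in> \<Lambda> + torsion_in UNIV D" if "l \<in> \<Lambda>" for l
    using that D_zero by (intro set_plus_intro) (auto simp: torsion_in_def)
  ultimately show "\<exists>x\<in>Z. y - x \<in> \<Lambda> + torsion_in UNIV D" by (intro bexI[of _ a]) auto
next
  fix a assume a: "a \<in> Z"
  have "0 + a \<in> \<Lambda> + D -` \<Lambda>'"
    using a add_subgroup_zero[OF \<Lambda>_subgroup] by (intro set_plus_intro) (auto simp: Z_def)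
  then show "a \<in> \<Lambda> + D -` \<Lambda>'" by simp
  show "a \<in> W 1 \<longleftrightarrow> a \<in> \<Lambda> + torsion_in UNIV D"
  proof
    assume "a \<in> W 1"
    then obtain l where l: "l \<in> \<Lambda>" "D a = D l" by (auto simp: W_def)
    then have "l + (a - l) \<in> \<Lambda> + torsion_in UNIV D"
      by (intro set_plus_intro) (auto simp: torsion_in_def D_diff)
    then show "a \<in> \<Lambda> + torsion_in UNIV D" by simp
  next
    assume "a \<in> \<Lambda> + torsion_in UNIV D"
    then show "a \<in> W 1" using a by (auto simp: W_def torsion_in_def D_add elim!: set_plus_elim)
  qed
qed (use Z_subgroup W_subgroup in auto)

section \<open>Exact count of the classes fixed by \<open>F\<close>\<close>

lemma quot_card_K_K'_pos: "0 < quot_card K K'"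
proof (rule quot_card_pos)
  fix x assume "x \<in> K"
  then show "\<exists>m>0. scale (of_nat m) x \<in> K'" using multiple_in_dual[of x] by (auto simp: D_scale)
qed (use kernel_subgroup[OF \<Lambda>_subgroup] kernel_subgroup[OF dual_subgroup] dual_subset in auto)

text \<open>Applying \<open>D\<close> splits the fixed part of \<Lambda> modulo e \<Lambda>' into a
  kernel part K/eK' and an image part. The image part is the middle layer of eDY \<le> eD\<Lambda>'
  \<le> eY \<inter> L \<le> eY. The top layer is e X, the bottom layer has the order of
  \<T>_D(\<Lambda>'), and the total is the index of DY in Y. The identity is kept multiplicative in
  the natural numbers.\<close>

lemma fixed_quotient_index:
  assumes e: "e > 0"
  shows "quot_card {x \<in> \<Lambda>. D x \<in> scale (of_nat e) ` \<Lambda>'} (scale (of_nat e) ` \<Lambda>')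
      * quot_card \<Lambda> (S + K) * quot_card Z (W e)
    = quot_card K K' * quot_card K (scale (of_nat e) ` K) * quot_card L (D ` L)"
proof -
  let ?e = "scale (of_nat e) :: 'v \<Rightarrow> 'v"
  let ?P = "{x \<in> \<Lambda>. D x \<in> ?e ` \<Lambda>'}"
  note sg = \<Lambda>_subgroup dual_subgroup L_subgroup Y_subgroup
    kernel_subgroup[OF \<Lambda>_subgroup] kernel_subgroup[OF dual_subgroup]
  have e_diff: "?e (x - y) = ?e x - ?e y" for x y by (simp add: scale_right_diff_distrib)
  have e_inj: "?e x = 0 \<Longrightarrow> x = 0" for x using e by simp
  have eD: "?e ` \<Lambda>' \<subseteq> \<Lambda>'" by (rule scale_stable[OF dual_subgroup])
  have P: "add_subgroup ?P" by (rule add_subgroup_preimage[OF sg(1) scale_subgroup[OF sg(2)] D_diff])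
  have M: "add_subgroup (?e ` \<Lambda>')" "?e ` \<Lambda>' \<subseteq> ?P"
    using eD dual_subset D_dual by (auto simp: D_scale scale_subgroup sg)
  have DY: "add_subgroup (D ` Y)" "add_subgroup (D ` \<Lambda>')"
    by (auto intro: add_subgroup_image sg D_diff)
  have "{x \<in> ?P. D x = 0} = K"
    using add_subgroup_zero[OF M(1)] by auto
  moreover have "{x \<in> ?e ` \<Lambda>'. D x = 0} = ?e ` K'" using e by (auto simp: D_scale)
  moreover have "D ` ?P = L \<inter> ?e ` \<Lambda>'" by auto
  moreover have "D ` ?e ` \<Lambda>' = ?e ` D ` \<Lambda>'" by (simp add: image_image D_scale)
  ultimately have 1: "quot_card ?P (?e ` \<Lambda>') = quot_card (L \<inter> ?e ` \<Lambda>') (?e ` D ` \<Lambda>') * quot_card K (?e ` K')"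
    using quot_card_image_kernel[OF P M D_diff] by simp
  have "quot_card K (?e ` K') = quot_card K K' * quot_card K' (?e ` K')"
    by (rule quot_card_mult)
      (use sg dual_subset scale_stable[OF sg(6)] in \<open>auto intro: scale_subgroup\<close>)
  moreover have "quot_card K (?e ` K) = quot_card K' (?e ` K')"
    by (rule quot_card_endo_commensurable[OF sg(5,6) _ quot_card_K_K'_pos e_diff e_inj])
      (use dual_subset scale_stable[OF sg(5)] scale_stable[OF sg(6)] in auto)
  ultimately have 2: "quot_card K (?e ` K') = quot_card K K' * quot_card K (?e ` K)" by simp
  \<comment> \<open>DV is a rational subspace, so \<open>e y\<close> in DV forces \<open>y\<close>
    in DV.\<close>
  have YL: "?e ` Y \<inter> L = L \<inter> ?e ` \<Lambda>'"
  proof (intro subset_antisym subsetI)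
    fix x assume x: "x \<in> L \<inter> ?e ` \<Lambda>'"
    then obtain y a where y: "y \<in> \<Lambda>'" "x = ?e y" "x = D a" by auto
    then have "y = D (scale (1 / of_nat e) a)" using e by (simp add: D_scale)
    then show "x \<in> ?e ` Y \<inter> L" using x y by blast
  qed auto
  have YLsg: "add_subgroup (?e ` Y \<inter> L)" by (intro add_subgroup_Int scale_subgroup sg)
  have sub: "?e ` D ` \<Lambda>' \<subseteq> ?e ` Y \<inter> L"
  proof -
    have "?e (D y) \<in> L" if "y \<in> \<Lambda>'" for y
      using dual_\<Lambda>[OF that] add_subgroup_scale_nat[OF sg(3)] by blast
    then show ?thesis using D_dual by auto
  qed
  have YK: "add_subgroup (Y + K')" "Y + K' \<subseteq> \<Lambda>'"
    using sg by (auto simp: add_subgroup_plus elim!: set_plus_elim intro: add_subgroup_add)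
  have K'0: "0 \<in> K'" "0 \<in> Y" using add_subgroup_zero sg by blast+
  have "D ` (Y + K') = D ` Y"
  proof (intro subset_antisym subsetI)
    fix x assume "x \<in> D ` Y"
    then obtain y where "y \<in> Y" "x = D (y + 0)" by auto
    then show "x \<in> D ` (Y + K')" using K'0 by blast
  qed (auto elim!: set_plus_elim simp: D_add)
  moreover have "{x \<in> Y + K'. D x = 0} = K'"
  proof (intro subset_antisym subsetI)
    fix x assume x: "x \<in> K'"
    then have "0 + x \<in> Y + K'" using K'0 by blast
    then show "x \<in> {x \<in> Y + K'. D x = 0}" using x by simp
  qed (use YK in auto)
  \<comment> \<open>\<open>D\<close> kills K', so the quotient of \<Lambda>' by Y + K' is carried
    isomorphically to \<open>D\<close> \<Lambda>'\<open>modulo\<close>D \<open>Y\<close>.\<close>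
  ultimately have 3: "quot_card \<Lambda>' (Y + K') = quot_card (D ` \<Lambda>') (D ` Y)"
    using quot_card_image_kernel[OF dual_subgroup YK D_diff] quot_card_self[OF sg(6)] by simp
  have DYY: "D ` Y \<subseteq> Y" using D_dual by auto
  have "quot_card Y (D ` Y) = quot_card (?e ` Y) (?e ` D ` Y)"
    by (rule quot_card_inj_image[symmetric, OF sg(4) DY(1) DYY e_diff e_inj])
  also have "\<dots> = quot_card (?e ` Y) (?e ` Y \<inter> L) * quot_card (?e ` Y \<inter> L) (?e ` D ` Y)"
    by (rule quot_card_mult[OF scale_subgroup[OF sg(4)] YLsg scale_subgroup[OF DY(1)]])
      (use sub in blast)+
  also have "quot_card (?e ` Y \<inter> L) (?e ` D ` Y)
      = quot_card (?e ` Y \<inter> L) (?e ` D ` \<Lambda>') * quot_card (?e ` D ` \<Lambda>') (?e ` D ` Y)"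
    by (rule quot_card_mult[OF YLsg scale_subgroup[OF DY(2)] scale_subgroup[OF DY(1)] _ sub]) blast
  also have "quot_card (?e ` D ` \<Lambda>') (?e ` D ` Y) = quot_card (D ` \<Lambda>') (D ` Y)"
    by (rule quot_card_inj_image[OF DY(2,1) _ e_diff e_inj]) auto
  finally have "quot_card L (D ` L)
      = quot_card Z (W e) * quot_card (L \<inter> ?e ` \<Lambda>') (?e ` D ` \<Lambda>') * quot_card \<Lambda> (S + K)"
    by (simp add: quot_card_Z_W YL quot_card_T_dual 3 quot_card_Y_D)
  then show ?thesis unfolding 1 2 by simp
qed

section \<open>Powers of the isometry\<close>

lemma Fpow_diff: "(F ^^ k) (x - y) = (F ^^ k) x - (F ^^ k) y"
  by (induction k) (simp_all add: F_diff)

lemma Fpow_add: "(F ^^ k) (x + y) = (F ^^ k) x + (F ^^ k) y"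
  by (induction k) (simp_all add: F_add)

lemma Fpow_F: "(F ^^ k) (F x) = F ((F ^^ k) x)"
  by (simp add: funpow_swap1)

lemma Fpow_isometry: "B ((F ^^ k) x) ((F ^^ k) y) = B x y"
  by (induction k) (simp_all add: isometry)

lemma Fpow_image:
  assumes "F ` A = A"
  shows "(F ^^ k) ` A = A"
proof (induction k)
  case (Suc k)
  have "(F ^^ Suc k) ` A = F ` (F ^^ k) ` A" by (simp add: image_image)
  then show ?case by (simp add: Suc assms)
qed simp

lemma scaled_dual_image: "F ` scale q ` \<Lambda>' = scale q ` \<Lambda>'"
proof -
  have "F ` scale q ` \<Lambda>' = scale q ` F ` \<Lambda>'" by (simp add: image_image F_scale)
  then show ?thesis by (simp add: F_dual_image)
qed

section \<open>Classes of \<Lambda> modulo e \<Lambda>' fixed by powers of \<open>F\<close>\<close>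

context
  fixes e :: nat
  assumes e: "e > 0"
begin

abbreviation "M \<equiv> scale (of_nat e) ` \<Lambda>'"
abbreviation "preimage C \<equiv> {x \<in> \<Lambda>. C x \<in> M}"

lemma M_subgroup: "add_subgroup M"
  by (rule scale_subgroup[OF dual_subgroup])

lemma M_subset: "M \<subseteq> \<Lambda>"
  using scale_stable[OF dual_subgroup] dual_subset by blast

lemma Fpow_M: "x \<in> M \<Longrightarrow> (F ^^ k) x \<in> M"
  using Fpow_image[OF scaled_dual_image] by blast

lemma F_M: "x \<in> M \<Longrightarrow> F x \<in> M"
  using Fpow_M[of x 1] by simp

lemma M_iff: "x \<in> M \<longleftrightarrow> (\<forall>l\<in>\<Lambda>. B x l / of_nat e \<in> \<int>)"
proof
  assume "x \<in> M"
  then show "\<forall>l\<in>\<Lambda>. B x l / of_nat e \<in> \<int>" using e by (auto simp: B_simps dual_iff)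
next
  assume *: "\<forall>l\<in>\<Lambda>. B x l / of_nat e \<in> \<int>"
  have "scale (1 / of_nat e) x \<in> \<Lambda>'" unfolding dual_iff using * by (simp add: B_simps)
  moreover have "x = scale (of_nat e) (scale (1 / of_nat e) x)" using e by simp
  ultimately show "x \<in> M" by blast
qed

lemma preimage_subgroup:
  assumes "\<And>x y. C (x - y) = C x - C y"
  shows "add_subgroup (preimage C)"
  by (rule add_subgroup_preimage[OF \<Lambda>_subgroup M_subgroup assms])

lemma preimage_index_pos:
  assumes C: "\<And>x y. C (x - y) = C x - C y"
  shows "0 < quot_card \<Lambda> (preimage C)"
proof (rule quot_card_pos[OF \<Lambda>_subgroup _ preimage_subgroup[OF C]])
  fix x assume x: "x \<in> \<Lambda>"
  obtain m where m: "m > 0" "scale (of_nat m) (scale (1 / of_nat e) (C x)) \<in> \<Lambda>'"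
    using multiple_in_dual by blast
  have "C (scale (of_nat m) x) = scale (of_nat m) (C x)"
    using additive_scale_int[OF C, of "int m" x] by simp
  also have "\<dots> = scale (of_nat e) (scale (of_nat m) (scale (1 / of_nat e) (C x)))"
    using e by simp
  finally have "C (scale (of_nat m) x) \<in> M" using m by blast
  then show "\<exists>m>0. scale (of_nat m) x \<in> preimage C"
    using m add_subgroup_scale_nat[OF \<Lambda>_subgroup x] by blast
qed auto

text \<open>The form (C x, F^j y)/e is alternating by hypothesis. As F^j permutes \<Lambda>, its
  radical is decided by \<open>C x\<close> alone, and \<open>M_iff\<close> identifies it. The twist
  by F^j is what makes suitable choices of \<open>C\<close> alternating.\<close>

lemma preimage_index_square:
  assumes C: "\<And>x y. C (x - y) = C x - C y" and alt: "\<And>x. B (C x) ((F ^^ j) x) = 0"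
  shows "\<exists>s>0. quot_card \<Lambda> (preimage C) = s\<^sup>2"
proof -
  let ?\<beta> = "\<lambda>x y. B (C x) ((F ^^ j) y) / of_nat e"
  have \<beta>: "biadditive ?\<beta>" by (simp add: biadditive_def B_simps C Fpow_diff diff_divide_distrib)
  have "(\<forall>y\<in>\<Lambda>. ?\<beta> x y \<in> \<int>) \<longleftrightarrow> (\<forall>y\<in>(F ^^ j) ` \<Lambda>. B (C x) y / of_nat e \<in> \<int>)" for x by simp
  then have "radical ?\<beta> \<Lambda> \<Lambda> = preimage C"
    unfolding radical_def M_iff Fpow_image[OF F_image] by simp
  then show ?thesis
    using quot_card_alternating_is_square[OF \<beta> \<Lambda>_subgroup] preimage_index_pos[OF C] alt by auto
qed

abbreviation "Fdiff f x \<equiv> (F ^^ f) x - x"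

lemma Fdiff_diff: "Fdiff f (x - y) = Fdiff f x - Fdiff f y"
  by (simp add: Fpow_diff)

lemma index_split:
  "quot_card \<Lambda> M = quot_card \<Lambda> (preimage (Fdiff f)) * quot_card (preimage (Fdiff f)) M"
proof (rule quot_card_mult[OF \<Lambda>_subgroup preimage_subgroup[OF Fdiff_diff] M_subgroup])
  show "M \<subseteq> preimage (Fdiff f)"
    using M_subset Fpow_M add_subgroup_diff[OF M_subgroup] by blast
qed auto

lemma quot_card_M: "quot_card \<Lambda> M = quot_card \<Lambda> \<Lambda>' * e ^ n"
proof -
  have "quot_card \<Lambda> M = quot_card \<Lambda> \<Lambda>' * quot_card \<Lambda>' M"
    by (rule quot_card_mult[OF \<Lambda>_subgroup dual_subgroup M_subgroup scale_stable[OF dual_subgroup] dual_subset])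
  moreover have "quot_card \<Lambda> (scale (of_nat e) ` \<Lambda>) = quot_card \<Lambda>' M"
    by (rule quot_card_endo_commensurable[OF \<Lambda>_subgroup dual_subgroup dual_subset quot_card_dual_pos])
      (use e scale_stable[OF \<Lambda>_subgroup] scale_stable[OF dual_subgroup]
        in \<open>auto simp: scale_right_diff_distrib\<close>)
  moreover have "int (quot_card \<Lambda> (scale (of_nat e) ` \<Lambda>)) = int (e ^ n)"
    using quot_card_scale_int[OF w, of "int e"] by (simp add: \<Lambda>)
  then have "quot_card \<Lambda> (scale (of_nat e) ` \<Lambda>) = e ^ n" by (simp only: of_nat_eq_iff)
  ultimately show ?thesis by simp
qed

text \<open>With f = 2m, the twist by F^m makes C = F^f - 1 alternating: (F^(2m) x, F^m x) = (F^m x,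
  x). Thus the non-fixed part contributes a square.\<close>

lemma fixed_even_power:
  assumes "even f"
  shows "\<exists>s>0. quot_card (preimage (Fdiff f)) M * s\<^sup>2 = quot_card \<Lambda> \<Lambda>' * e ^ n"
proof -
  obtain m where f: "f = m + m" using assms by (auto elim!: evenE simp: mult_2)
  have "B (Fdiff f x) ((F ^^ m) x) = 0" for x
  proof -
    have "B ((F ^^ f) x) ((F ^^ m) x) = B ((F ^^ m) x) x"
      unfolding f funpow_add comp_def by (rule Fpow_isometry)
    then show ?thesis using B_sym by (simp add: B_simps)
  qed
  from preimage_index_square[OF Fdiff_diff this]
  obtain s where s: "s > 0" "quot_card \<Lambda> (preimage (Fdiff f)) = s\<^sup>2" by auto
  have "quot_card (preimage (Fdiff f)) M * s\<^sup>2 = quot_card \<Lambda> \<Lambda>' * e ^ n"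
    using index_split[of f] unfolding s(2) quot_card_M by simp
  then show ?thesis using s(1) by blast
qed

text \<open>This is 1 + F + ... + F^(2m), with all terms but the first paired as F^(2i+1) (1 + F),
  so that the pairs visibly vanish where F = -1.\<close>

definition norm_sum :: "nat \<Rightarrow> 'v \<Rightarrow> 'v" where
  "norm_sum m x = x + (\<Sum>i<m. (F ^^ (2 * i + 1)) (x + F x))"

lemma norm_sum_Suc: "norm_sum (Suc m) x = norm_sum m x + (F ^^ (2 * m + 1)) (x + F x)"
  by (simp add: norm_sum_def add.assoc)

lemma norm_sum_0: "norm_sum 0 x = x"
  by (simp add: norm_sum_def)

lemma norm_sum_add: "norm_sum m (x + y) = norm_sum m x + norm_sum m y"
  by (induction m) (simp_all add: norm_sum_0 norm_sum_Suc F_add Fpow_add del: funpow.simps)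

lemma norm_sum_F: "norm_sum m (F x) = F (norm_sum m x)"
  by (induction m) (simp_all add: norm_sum_0 norm_sum_Suc F_add Fpow_add Fpow_F del: funpow.simps)

lemma norm_sum_diff: "norm_sum m (x - y) = norm_sum m x - norm_sum m y"
  by (rule additive_diffI) (rule norm_sum_add)

lemma norm_sum_D: "norm_sum m (D x) = Fdiff (2 * m + 1) x"
proof (induction m)
  case (Suc m)
  have "D x + F (D x) = F (F x) - x" by (simp add: D_eq F_diff)
  then show ?case unfolding norm_sum_Suc Suc by (simp add: Fpow_diff Fpow_F F_diff)
qed (simp add: norm_sum_0 D_eq)

lemma norm_sum_closed:
  assumes "add_subgroup A" "\<And>x. x \<in> A \<Longrightarrow> F x \<in> A" "x \<in> A"
  shows "norm_sum m x \<in> A"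
proof -
  have "(F ^^ k) y \<in> A" if "y \<in> A" for k y using that assms(2) by (induction k) auto
  then show ?thesis
    by (induction m) (simp_all add: norm_sum_0 norm_sum_Suc assms add_subgroup_add del: funpow.simps)
qed

text \<open>On the part of the quotient where \<open>F = -1\<close> the alternating sum collapses to one term.\<close>
lemma norm_sum_cong:
  assumes "v + F v \<in> M"
  shows "norm_sum m v - v \<in> M"
proof (induction m)
  case (Suc m)
  have "norm_sum (Suc m) v - v = (norm_sum m v - v) + (F ^^ (2 * m + 1)) (v + F v)"
    unfolding norm_sum_Suc by simp
  then show ?case using Suc Fpow_M[OF assms] add_subgroup_add[OF M_subgroup] by metis
qed (simp add: norm_sum_0 add_subgroup_zero[OF M_subgroup])

abbreviation "Fsym f x \<equiv> Fdiff f x + F (Fdiff f x)"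

lemma Fsym_diff: "Fsym f (x - y) = Fsym f x - Fsym f y"
  by (simp add: Fpow_diff F_diff)

lemma preimage_Fdiff_subset: "preimage (Fdiff f) \<subseteq> preimage (Fsym f)"
  using F_M add_subgroup_add[OF M_subgroup] by blast

text \<open>After the twist by F^(m+1), invariance makes the four terms cancel in pairs: both
  products in the first pair equal (F^(m+1) x, x), both in the second (F^m x, x).\<close>

lemma Fsym_index_square: "\<exists>s>0. quot_card \<Lambda> (preimage (Fsym (2 * m + 1))) = s\<^sup>2"
proof (rule preimage_index_square[OF Fsym_diff])
  fix x
  have 1: "B (F ((F ^^ (2 * m + 1)) x)) ((F ^^ (m + 1)) x) = B ((F ^^ (m + 1)) x) x"
  proof -
    have "F ((F ^^ (2 * m + 1)) x) = (F ^^ (m + 1 + (m + 1))) x" by (simp add: mult_2)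
    then show ?thesis unfolding funpow_add comp_def by (simp only: Fpow_isometry)
  qed
  have 2: "B ((F ^^ (2 * m + 1)) x) ((F ^^ (m + 1)) x) = B ((F ^^ m) x) x"
  proof -
    have "(F ^^ (2 * m + 1)) x = (F ^^ (m + 1 + m)) x" by (simp add: mult_2)
    then show ?thesis unfolding funpow_add comp_def by (simp only: Fpow_isometry)
  qed
  have 3: "B (F x) ((F ^^ (m + 1)) x) = B x ((F ^^ m) x)"
    by (simp add: isometry)
  have "B (Fsym (2 * m + 1) x) ((F ^^ (m + 1)) x)
      = B ((F ^^ (2 * m + 1)) x) ((F ^^ (m + 1)) x) - B x ((F ^^ (m + 1)) x)
        + (B (F ((F ^^ (2 * m + 1)) x)) ((F ^^ (m + 1)) x) - B (F x) ((F ^^ (m + 1)) x))"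
    by (simp only: B_simps F_diff)
  also have "\<dots> = 0" unfolding 1 2 3 using B_sym by simp
  finally show "B (Fsym (2 * m + 1) x) ((F ^^ (m + 1)) x) = 0" .
qed

text \<open>Both quotients are the part with F = -1 of the image of F^f - 1 in \<Lambda>/M, for
  exponents 1 and f. Let N be \<open>norm_sum m\<close>. Then F^f - 1 = N D, and N is the identity
  modulo M where F = -1, so inclusion induces an isomorphism.\<close>

lemma Fsym_Fdiff_index:
  "quot_card (preimage (Fsym 1)) (preimage (Fdiff 1))
    = quot_card (preimage (Fsym (2 * m + 1))) (preimage (Fdiff (2 * m + 1)))"
proof (rule quot_card_iso[OF preimage_subgroup[OF Fdiff_diff] preimage_subgroup[OF Fsym_diff]
      preimage_subgroup[OF Fdiff_diff], where h = "\<lambda>x. x"])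
  let ?f = "2 * m + 1"
  have D1: "Fdiff 1 x = D x" for x by (simp add: D_eq)
  have Df: "Fdiff ?f x = norm_sum m (D x)" for x by (rule norm_sum_D[symmetric])
  have DN: "D (norm_sum m x) = Fdiff ?f x" for x
    unfolding norm_sum_D[symmetric] by (simp only: D_eq norm_sum_F norm_sum_diff)
  show "x \<in> preimage (Fsym ?f)" if x: "x \<in> preimage (Fsym 1)" for x
  proof -
    have "Fsym ?f x = norm_sum m (D x + F (D x))"
      unfolding Df by (simp only: norm_sum_add norm_sum_F)
    moreover have "norm_sum m (D x + F (D x)) \<in> M"
      by (rule norm_sum_closed[OF M_subgroup F_M]) (use x in \<open>simp_all only: D1 mem_Collect_eq\<close>)
    ultimately show ?thesis using x by simp
  qed
  \<comment> \<open>The witness N y works because D N y = (F^f - 1) y. With v = (F^f - 1) y, the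
    difference y - N y is sent by F^f - 1 to v - N v, which lies in M.\<close>
  show "\<exists>x\<in>preimage (Fsym 1). y - x \<in> preimage (Fdiff ?f)" if y: "y \<in> preimage (Fsym ?f)" for y
  proof (rule bexI[of _ "norm_sum m y"])
    have y\<Lambda>: "y \<in> \<Lambda>" "norm_sum m y \<in> \<Lambda>" and yM: "Fsym ?f y \<in> M"
      using y norm_sum_closed[OF \<Lambda>_subgroup F_\<Lambda>] by simp_all
    have "Fsym 1 (norm_sum m y) = Fsym ?f y" unfolding D1 DN ..
    then show "norm_sum m y \<in> preimage (Fsym 1)" using y\<Lambda> yM by simp
    have "Fdiff ?f (y - norm_sum m y) = - (norm_sum m (Fdiff ?f y) - Fdiff ?f y)"
      unfolding Fdiff_diff Df[of "norm_sum m y"] DN by simp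
    moreover have "norm_sum m (Fdiff ?f y) - Fdiff ?f y \<in> M" by (rule norm_sum_cong[OF yM])
    ultimately have "Fdiff ?f (y - norm_sum m y) \<in> M"
      using add_subgroup_uminus[OF M_subgroup] by metis
    then show "y - norm_sum m y \<in> preimage (Fdiff ?f)"
      using add_subgroup_diff[OF \<Lambda>_subgroup y\<Lambda>] by simp
  qed
  show "x \<in> preimage (Fdiff 1) \<longleftrightarrow> x \<in> preimage (Fdiff ?f)" if x: "x \<in> preimage (Fsym 1)" for x
  proof -
    have "D x + F (D x) \<in> M" "x \<in> \<Lambda>" using x by (simp_all only: D1 mem_Collect_eq)
    then have c: "norm_sum m (D x) - D x \<in> M" by (intro norm_sum_cong)
    have "D x \<in> M \<longleftrightarrow> norm_sum m (D x) \<in> M"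
      using add_subgroup_add[OF M_subgroup c, of "D x"]
        add_subgroup_diff[OF M_subgroup _ c, of "norm_sum m (D x)"] by auto
    then show ?thesis using \<open>x \<in> \<Lambda>\<close> unfolding mem_Collect_eq D1 Df by blast
  qed
qed (rule refl)

text \<open>For every odd exponent the non-fixed part has order a square times the same number
  \<open>g\<close>. Cancelling \<open>g\<close> in the two factorisations of the index of M leaves
  squares only.\<close>

lemma fixed_odd_power:
  assumes "odd f"
  shows "\<exists>s>0. \<exists>t>0. quot_card (preimage (Fdiff f)) M * s\<^sup>2 = quot_card (preimage D) M * t\<^sup>2"
proof -
  obtain m where f: "f = 2 * m + 1" using assms by (elim oddE)
  define g where "g = quot_card (preimage (Fsym 1)) (preimage (Fdiff 1))"
  have chain: "quot_card \<Lambda> (preimage (Fdiff k))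
      = quot_card \<Lambda> (preimage (Fsym k)) * quot_card (preimage (Fsym k)) (preimage (Fdiff k))" for k
    by (rule quot_card_mult[OF \<Lambda>_subgroup preimage_subgroup[OF Fsym_diff]
          preimage_subgroup[OF Fdiff_diff] preimage_Fdiff_subset]) auto
  obtain s t where st: "s > 0" "quot_card \<Lambda> (preimage (Fsym f)) = s\<^sup>2"
    "t > 0" "quot_card \<Lambda> (preimage (Fsym 1)) = t\<^sup>2"
    using Fsym_index_square[of m] Fsym_index_square[of 0] f by auto
  have idx: "quot_card \<Lambda> (preimage (Fdiff f)) = s\<^sup>2 * g" "quot_card \<Lambda> (preimage (Fdiff 1)) = t\<^sup>2 * g"
    using chain[of f] chain[of 1] st Fsym_Fdiff_index[of m] unfolding g_def f by simp_all
  have g: "g > 0" using idx(2) preimage_index_pos[of "Fdiff 1", OF Fdiff_diff] by simp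
  have "preimage (Fdiff 1) = preimage D" by (simp add: D_eq)
  then have "s\<^sup>2 * g * quot_card (preimage (Fdiff f)) M = t\<^sup>2 * g * quot_card (preimage D) M"
    using trans[OF index_split[of f, unfolded idx, symmetric] index_split[of 1, unfolded idx]]
    by (simp only:)
  then have "g * (quot_card (preimage (Fdiff f)) M * s\<^sup>2) = g * (quot_card (preimage D) M * t\<^sup>2)"
    by (simp only: ac_simps)
  then have "quot_card (preimage (Fdiff f)) M * s\<^sup>2 = quot_card (preimage D) M * t\<^sup>2"
    using g nat_mult_eq_cancel1 by blast
  then show ?thesis using st by blast
qed

text \<open>F^f permutes M, so the coset of \<open>a\<close> goes to the coset of F^f a, and it is
  fixed iff (F^f - 1) a lies in M.\<close>

lemma card_quot_fixed:
  "card (quot_fixed \<Lambda> M (F ^^ f)) = quot_card (preimage (Fdiff f)) M"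
proof -
  let ?c = "\<lambda>a. (\<lambda>b. b + a) ` M"
  have img: "(F ^^ f) ` ?c a = ?c ((F ^^ f) a)" for a
  proof -
    have "(F ^^ f) ` ?c a = (\<lambda>b. b + (F ^^ f) a) ` (F ^^ f) ` M"
      by (simp add: image_image Fpow_add)
    then show ?thesis unfolding Fpow_image[OF scaled_dual_image] .
  qed
  have "quot_fixed \<Lambda> M (F ^^ f) = ?c ` preimage (Fdiff f)"
  proof (intro subset_antisym subsetI)
    fix C assume "C \<in> quot_fixed \<Lambda> M (F ^^ f)"
    then obtain a where a: "a \<in> \<Lambda>" "C = ?c a" "(F ^^ f) ` ?c a = ?c a"
      unfolding quot_fixed_def fixed_in_def carrier_quot_group by blast
    then have "Fdiff f a \<in> M" unfolding img coset_eq_iff[OF M_subgroup] by simp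
    then show "C \<in> ?c ` preimage (Fdiff f)" using a by blast
  next
    fix C assume "C \<in> ?c ` preimage (Fdiff f)"
    then obtain a where a: "a \<in> \<Lambda>" "Fdiff f a \<in> M" "C = ?c a" by blast
    then have "(F ^^ f) ` ?c a = ?c a" unfolding img coset_eq_iff[OF M_subgroup] by simp
    then show "C \<in> quot_fixed \<Lambda> M (F ^^ f)"
      using a unfolding quot_fixed_def fixed_in_def carrier_quot_group by blast
  qed
  then show ?thesis by (simp add: quot_card_def carrier_quot_group)
qed

end

end

section \<open>From bases of lattices to integer combinations\<close>

context rat_space
begin

lemma module_int_scale: "Modules.module (int_scale scale)"
  by unfold_locales (auto simp: int_scale_def scale_right_distrib scale_left_distrib)

lemma sum_set_nth:
  assumes "distinct bs"
  shows "(\<Sum>v\<in>set bs. g v) = (\<Sum>i<length bs. g (bs ! i))"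
  using sum.reindex_bij_betw[OF bij_betw_nth[OF assms refl refl], of g] by simp

lemma lattice_basis_int_span:
  assumes "lattice_basis scale \<Lambda> bs"
  shows "\<Lambda> = int_span ((!) bs) (length bs)" and "int_indep ((!) bs) (length bs)"
proof -
  interpret Z: Modules.module "int_scale scale" by (rule module_int_scale)
  have bs: "distinct bs" "Z.independent (set bs)" "Z.span (set bs) = \<Lambda>"
    using assms by (simp_all add: lattice_basis_def)
  have comb: "(\<Sum>v\<in>set bs. int_scale scale (c v) v) = int_comb ((!) bs) (length bs) (\<lambda>i. c (bs ! i))" for c
    by (simp add: sum_set_nth[OF bs(1)] int_comb_def int_scale_def)
  \<comment> \<open>Position of a basis vector in the list; it translates coefficients indexed by
    numbers into coefficients indexed by vectors.\<close>
  define idx where "idx v = (THE i. i < length bs \<and> bs ! i = v)" for v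
  have idx: "idx (bs ! i) = i" if "i < length bs" for i
    unfolding idx_def using that bs(1) by (auto simp: nth_eq_iff_index_eq)
  have comb': "int_comb ((!) bs) (length bs) a = (\<Sum>v\<in>set bs. int_scale scale (a (idx v)) v)" for a
    unfolding comb by (rule int_comb_cong) (auto simp: idx)
  show "\<Lambda> = int_span ((!) bs) (length bs)"
  proof (intro subset_antisym subsetI)
    fix x assume "x \<in> \<Lambda>"
    then show "x \<in> int_span ((!) bs) (length bs)"
      unfolding bs(3)[symmetric] Z.span_finite[OF finite_set] by (auto simp: comb int_span_def)
  next
    fix x assume "x \<in> int_span ((!) bs) (length bs)"
    then obtain a where "x = (\<Sum>v\<in>set bs. int_scale scale (a (idx v)) v)"
      by (auto simp: int_span_def comb')
    then show "x \<in> \<Lambda>"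
      unfolding bs(3)[symmetric] Z.span_finite[OF finite_set] by (intro range_eqI[of _ _ "\<lambda>v. a (idx v)"])
  qed
  show "int_indep ((!) bs) (length bs)"
    unfolding int_indep_def
  proof (intro allI impI)
    fix a i assume a: "int_comb ((!) bs) (length bs) a = 0" and i: "i < length bs"
    have "a (idx (bs ! i)) = 0"
      by (rule Z.independentD[OF bs(2) finite_set subset_refl]) (use a i in \<open>auto simp: comb'\<close>)
    then show "a i = 0" using idx[OF i] by simp
  qed
qed

lemma lattice_basis_denominator:
  assumes "lattice_basis scale \<Lambda> bs"
  shows "\<exists>m>0. scale (of_nat m) v \<in> \<Lambda>"
proof -
  have \<Lambda>: "add_subgroup \<Lambda>"
    unfolding lattice_basis_int_span(1)[OF assms] by (rule add_subgroup_int_span)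
  have base: "b \<in> \<Lambda>" if "b \<in> set bs" for b
    using that int_span_base[of _ "length bs" "(!) bs"]
    unfolding lattice_basis_int_span(1)[OF assms] by (auto simp: in_set_conv_nth)
  have "v \<in> span (set bs)" using assms by (simp add: lattice_basis_def)
  then show ?thesis
  proof (induction rule: span_induct_alt)
    case base
    show ?case using add_subgroup_zero[OF \<Lambda>] by (intro exI[of _ 1]) simp
  next
    case (step c x y)
    obtain m where m: "m > 0" "scale (of_nat m) y \<in> \<Lambda>" using step by blast
    obtain a d where c: "c = of_int a / of_int d" "d > 0"
      using quotient_of_div quotient_of_denom_pos by (metis surj_pair)
    have "scale (of_nat (nat d * m)) (scale c x + y)
        = scale (of_int (a * int m)) x + scale (of_nat (nat d)) (scale (of_nat m) y)"
      using c by (simp add: scale_right_distrib mult.commute)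
    moreover have "scale (of_int (a * int m)) x + scale (of_nat (nat d)) (scale (of_nat m) y) \<in> \<Lambda>"
      using add_subgroup_scale_int[OF \<Lambda> base[OF step(1)]] add_subgroup_scale_nat[OF \<Lambda> m(2)]
      by (intro add_subgroup_add[OF \<Lambda>])
    ultimately show ?case using m c by (intro exI[of _ "nat d * m"]) simp
  qed
qed

lemma endo_mat_column:
  assumes bs: "lattice_basis scale \<Lambda> bs" and x: "F (bs ! j) \<in> \<Lambda>" "j < length bs"
  shows "F (bs ! j) = int_comb ((!) bs) (length bs) (\<lambda>i. endo_mat scale bs F $$ (i, j))"
proof -
  interpret Z: Modules.module "int_scale scale" by (rule module_int_scale)
  have b: "distinct bs" "Z.independent (set bs)" "Z.span (set bs) = \<Lambda>"
    using bs by (simp_all add: lattice_basis_def)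
  have "F (bs ! j) = (\<Sum>v\<in>set bs. int_scale scale (Z.representation (set bs) (F (bs ! j)) v) v)"
    using Z.sum_representation_eq[OF b(2) _ finite_set subset_refl] x b(3) by simp
  also have "\<dots> = int_comb ((!) bs) (length bs) (\<lambda>i. Z.representation (set bs) (F (bs ! j)) (bs ! i))"
    by (simp add: sum_set_nth[OF b(1)] int_comb_def int_scale_def)
  also have "\<dots> = int_comb ((!) bs) (length bs) (\<lambda>i. endo_mat scale bs F $$ (i, j))"
    by (rule int_comb_cong) (simp_all add: endo_mat_def x)
  finally show ?thesis .
qed

end

section \<open>Assembly of the square classes\<close>

lemma sq_equivI:
  fixes N N' :: rat
  assumes "N * s\<^sup>2 = N' * t\<^sup>2" "s \<noteq> 0" "t \<noteq> 0"
  shows "sq_equiv N N'"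
  unfolding sq_equiv_def
  by (rule exI[of _ "t / s"]) (use assms in \<open>simp add: field_simps\<close>)

text \<open>\<open>Nf\<close> and \<open>N1\<close> count the classes fixed by F^f and by F;
  \<open>T\<close>, \<open>We\<close> and \<open>W1\<close> stand for the orders of
  \<T>_D(\<Lambda>), e X and X. The reduction to f = 1, the exact count and the comparison of e X
  with X are combined.\<close>

lemma square_class_identity:
  fixes Nf N1 T We W1 c P E s t a b :: rat
  assumes "Nf * s\<^sup>2 = N1 * t\<^sup>2" "N1 * T * We = c * E * P" "We * a\<^sup>2 = W1 * b\<^sup>2" "T \<noteq> 0" "W1 \<noteq> 0"
  shows "Nf * (s * b)\<^sup>2 = c * (P / (W1 * T)) * E * (t * a)\<^sup>2"
proof -
  have "Nf * (s * b)\<^sup>2 * (W1 * T) = (Nf * s\<^sup>2) * (W1 * b\<^sup>2) * T"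
    by (simp add: power_mult_distrib)
  also have "\<dots> = (N1 * T * We) * (t * a)\<^sup>2"
    unfolding assms(1) assms(3)[symmetric] by (simp add: power_mult_distrib)
  also have "\<dots> = c * P * E * (t * a)\<^sup>2"
    unfolding assms(2) by simp
  finally have "Nf * (s * b)\<^sup>2 = c * P * E * (t * a)\<^sup>2 / (W1 * T)"
    using assms(4,5) by (simp add: eq_divide_eq)
  then show ?thesis by simp
qed

theorem theorem2p4p4:
  fixes scale :: "rat \<Rightarrow> 'v \<Rightarrow> 'v::ab_group_add"
    and \<Lambda> :: "'v set"
    and F D :: "'v \<Rightarrow> 'v"
    and B :: "'v \<Rightarrow> 'v \<Rightarrow> rat"
    and p :: "int poly"
    and r e f :: nat
  assumes "vector_space scale"
    and "is_lattice scale \<Lambda>"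
    and "Vector_Spaces.linear scale scale F" and "bij_betw F \<Lambda> \<Lambda>"
    and "\<And>v. F v = v + D v"
    and "torsion_in \<Lambda> D = torsion_in \<Lambda> (D ^^ 2)"
    and "nondeg_sym_pairing scale B"
    and "\<And>v w. B (F v) (F w) = B v w"
    and "dual_lattice B \<Lambda> \<subseteq> \<Lambda>"
    and "lattice_char_poly scale \<Lambda> F = [:-1, 1:] ^ r * p \<or>
         lattice_char_poly scale \<Lambda> F = - ([:-1, 1:] ^ r * p)"
    and "poly p 1 > 0"
    and "e > 0" and "f > 0"
  shows
    "sq_equiv
       (of_nat (card (quot_fixed \<Lambda> (scale (of_nat e) ` dual_lattice B \<Lambda>) (F ^^ f))))
       (if odd e \<and> odd f then
          of_nat (quot_card (fixed_in \<Lambda> F) (fixed_in (dual_lattice B \<Lambda>) F))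
          * (of_int (poly p 1)
             / (of_nat (card (carrier (B_group D \<Lambda> (dual_lattice B \<Lambda>))))
                * of_nat (card (carrier (T_group D \<Lambda>)))))
          * of_nat e ^ r
        else if even e \<and> odd f then
          of_nat (quot_card (fixed_in \<Lambda> F) (fixed_in (dual_lattice B \<Lambda>) F))
          * (of_int (poly p 1) / of_nat (card (carrier (T_group D \<Lambda>))))
          * of_nat e ^ r
        else
          of_nat (quot_card \<Lambda> (dual_lattice B \<Lambda>)) * of_nat e ^ lattice_rank scale \<Lambda>)"
proof -
  interpret vector_space scale by fact
  interpret rat_space scale ..
  define bs where "bs = some_basis scale \<Lambda>"
  have bs: "lattice_basis scale \<Lambda> bs"
    using assms(2) unfolding bs_def some_basis_def is_lattice_def by (rule someI_ex)
  interpret F: Vector_Spaces.linear scale scale F by fact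
  have linB: "Vector_Spaces.linear scale (*) (B v)" "Vector_Spaces.linear scale (*) (\<lambda>v. B v w)"
    and symB: "B v w = B w v" for v w
    using assms(7) by (auto simp: nondeg_sym_pairing_def)
  have B_scale: "B (scale q x) y = q * B x y" for q x y
    using linB(2)[of y] by (simp add: Vector_Spaces.linear_iff)
  have B_diff: "B (x - y) z = B x z - B y z" for x y z
    by (rule additive_diffI) (use linB(2)[of z] in \<open>simp add: Vector_Spaces.linear_iff\<close>)
  interpret lattice_isometry scale "(!) bs" "length bs" \<Lambda> F D B
  proof
    show "biadditive B" unfolding biadditive_def using B_diff symB by metis
    \<comment> \<open>The hypothesis \<Lambda>[D] = \<Lambda>[D^2], stated elementwise.\<close>
    show "D v = 0" if "v \<in> \<Lambda>" "D (D v) = 0" for v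
    proof -
      have "v \<in> torsion_in \<Lambda> (D ^^ 2)" using that by (simp add: torsion_in_def numeral_2_eq_2)
      then show ?thesis using assms(6) by (auto simp: torsion_in_def)
    qed
    show "F ` \<Lambda> = \<Lambda>" using assms(4) by (simp add: bij_betw_def)
  qed (use lattice_basis_int_span[OF bs] lattice_basis_denominator[OF bs] F.diff F.scale
      assms(5,8,9) symB B_scale in blast)+
  note e = \<open>e > 0\<close>
  let ?A = "quot_card {x \<in> \<Lambda>. D x \<in> scale (of_nat e) ` dual_lattice B \<Lambda>} (scale (of_nat e) ` dual_lattice B \<Lambda>)"
  let ?Af = "quot_card {x \<in> \<Lambda>. (F ^^ f) x - x \<in> scale (of_nat e) ` dual_lattice B \<Lambda>}
    (scale (of_nat e) ` dual_lattice B \<Lambda>)"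
  have lhs: "card (quot_fixed \<Lambda> (scale (of_nat e) ` dual_lattice B \<Lambda>) (F ^^ f)) = ?Af"
    by (rule card_quot_fixed[OF e])
  have fixed: "fixed_in \<Lambda> F = K" "fixed_in (dual_lattice B \<Lambda>) F = K'"
    by (auto simp: fixed_in_def F_D)
  have T: "card (carrier (T_group D \<Lambda>)) = quot_card \<Lambda> (S + K)"
  proof -
    have "\<Lambda> \<inter> torsion_in UNIV D = K" by (auto simp: torsion_in_def)
    then show ?thesis by (simp add: T_group_def quot_card_def)
  qed
  have BB: "card (carrier (B_group D \<Lambda> (dual_lattice B \<Lambda>))) = quot_card Z (W 1)"
    using quot_card_B_group by (simp add: B_group_def quot_card_def)
  have rank: "lattice_rank scale \<Lambda> = length bs" by (simp add: lattice_rank_def bs_def)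
  have mat: "endo_mat scale bs F \<in> carrier_mat (length bs) (length bs)" by (simp add: endo_mat_def)
  have "bs ! j \<in> \<Lambda>" if "j < length bs" for j
    using int_span_base[OF that, of "(!) bs"] lattice_basis_int_span(1)[OF bs] by simp
  then have col: "F (bs ! j) = int_comb ((!) bs) (length bs) (\<lambda>i. endo_mat scale bs F $$ (i, j))"
    if "j < length bs" for j
    using endo_mat_column[OF bs _ that] F_\<Lambda> that by blast
  have char: "char_poly (endo_mat scale bs F) = [:-1, 1:] ^ r * p \<or>
      char_poly (endo_mat scale bs F) = - ([:-1, 1:] ^ r * p)"
    using assms(10) by (simp add: lattice_char_poly_def bs_def)
  have p: "int (quot_card L (D ` L)) = poly p 1" "quot_card K (scale (of_nat e) ` K) = e ^ r"
    by (rule char_poly_at_one[OF mat _ char assms(11)]; use col e in blast)+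
  have p1: "of_int (poly p 1) = (of_nat (quot_card L (D ` L)) :: rat)"
    using arg_cong[OF p(1), of rat_of_int] by simp
  have "?A * quot_card \<Lambda> (S + K) * quot_card Z (W e) = quot_card K K' * e ^ r * quot_card L (D ` L)"
    using fixed_quotient_index[OF e] p(2) by simp
  from arg_cong[OF this, of rat_of_nat] have A: "of_nat ?A * of_nat (quot_card \<Lambda> (S + K)) * of_nat (quot_card Z (W e))
      = of_nat (quot_card K K') * of_nat e ^ r * (of_int (poly p 1) :: rat)"
    unfolding p1 by (simp only: of_nat_mult of_nat_power)
  have pos: "of_nat (quot_card \<Lambda> (S + K)) \<noteq> (0::rat)" "of_nat (quot_card Z (W e)) \<noteq> (0::rat)"
    "of_nat (quot_card Z (W 1)) \<noteq> (0::rat)"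
    using quot_card_T_pos quot_card_Z_W_pos by simp_all
  show ?thesis
  proof (cases "odd f")
    case False
    then obtain s where s: "s > 0" "?Af * s\<^sup>2 = quot_card \<Lambda> (dual_lattice B \<Lambda>) * e ^ length bs"
      using fixed_even_power[OF e] by blast
    from arg_cong[OF s(2), of rat_of_nat] have "of_nat ?Af * (of_nat s)\<^sup>2
        = of_nat (quot_card \<Lambda> (dual_lattice B \<Lambda>)) * of_nat e ^ length bs * (1::rat)\<^sup>2"
      by (simp only: of_nat_mult of_nat_power one_power2 mult_1_right)
    then show ?thesis using False s(1) unfolding lhs rank by (simp add: sq_equivI[where s = "of_nat s" and t = 1])
  next
    case True
    then obtain s t where st: "s > 0" "t > 0" "?Af * s\<^sup>2 = ?A * t\<^sup>2"
      using fixed_odd_power[OF e] by blast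
    from arg_cong[OF st(3), of rat_of_nat] have Af: "of_nat ?Af * (of_nat s)\<^sup>2 = of_nat ?A * (of_nat t :: rat)\<^sup>2"
      by (simp only: of_nat_mult of_nat_power)
    show ?thesis
    proof (cases "odd e")
      case odd: True
      obtain a b where ab: "a > 0" "b > 0" "quot_card Z (W e) * a\<^sup>2 = quot_card Z (W 1) * b\<^sup>2"
        using quot_card_Z_W_odd[OF odd] by blast
      from arg_cong[OF ab(3), of rat_of_nat] have W: "of_nat (quot_card Z (W e)) * (of_nat a)\<^sup>2 = of_nat (quot_card Z (W 1)) * (of_nat b :: rat)\<^sup>2"
        by (simp only: of_nat_mult of_nat_power)
      have "of_nat ?Af * (of_nat (s * b))\<^sup>2
          = of_nat (quot_card K K') * (of_int (poly p 1)
            / (of_nat (quot_card Z (W 1)) * of_nat (quot_card \<Lambda> (S + K)))) * of_nat e ^ r * (of_nat (t * a) :: rat)\<^sup>2"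
        unfolding of_nat_mult by (rule square_class_identity[OF Af A W pos(1,3)])
      then show ?thesis using True odd st ab unfolding lhs fixed T BB
        by (simp add: sq_equivI[where s = "of_nat (s * b)" and t = "of_nat (t * a)"])
    next
      case even: False
      obtain a where a: "a > 0" "quot_card Z (W e) = a\<^sup>2" using quot_card_Z_W_even[of e] even by auto
      \<comment> \<open>For even e the order of e X is itself a square, so the identity is used with
        \<open>W1 = 1\<close> and the order of \<BB> disappears.\<close>
      have "of_nat ?Af * (of_nat (s * a))\<^sup>2
          = of_nat (quot_card K K') * (of_int (poly p 1) / of_nat (quot_card \<Lambda> (S + K)))
            * of_nat e ^ r * (of_nat t :: rat)\<^sup>2"
        using square_class_identity[OF Af A, of 1 1 "of_nat a"] pos(1) a(2) by simp
      then show ?thesis using True even st a unfolding lhs fixed T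
        by (simp add: sq_equivI[where s = "of_nat (s * a)" and t = "of_nat t"])
    qed
  qed
qed

end
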